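(* The Intersection Non-emptiness problem for totally star-free NFAs accepting star-free commutative languages (i.e., commutative languages in $\mathsf{ST}_{3/2}$) is in $\mathsf{XP}$ with the size of the alphabet as the parameter; that is, it can be solved in time $N^{f(|\Sigma|)}$ for some computable function $f$, where $N$ is the input size.
   Context: An NFA $A=(Q,\Sigma,\delta,q_0,F)$ (single initial state, no $\varepsilon$-transitions) is totally star-free if for all states $q,p\in Q$ the language accepted by $(Q,\Sigma,\delta,q,\{p\})$ is star-free. Star-free languages are those obtained from finite languages by union, concatenation and complement. A language is commutative if $uabv\in L$ implies $ubav\in L$ for all letters $a,b$ and words $u,v$. $\mathsf{ST}_{3/2}$ consists of finite unions of languages $\Sigma_0^*a_1\Sigma_1^*\cdots a_k\Sigma_k^*$ ($a_i\in\Sigma$, $\Sigma_i\subseteq\Sigma$). The problem: given totally star-free NFAs $A_1,\dots,A_m$ over a common alphabet $\Sigma$, promised each accepts a star-free commutative language, decide whether $\bigcap_i L(A_i)\neq\emptyset$. *)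

theory Defs
  imports Main
begin

text \<open>Symbols are naturals, 0 is the blank. A machine is a finite list of rules
  ((state, read symbol), (new state, written symbol, head move)); the first matching
  rule is used; if no rule matches, the machine halts. Start state is 0.\<close>

type_synonym tm = "((nat \<times> nat) \<times> (nat \<times> nat \<times> int)) list"

type_synonym config = "nat \<times> (int \<Rightarrow> nat) \<times> int"

definition wf_tm :: "tm \<Rightarrow> bool" where
  "wf_tm M \<longleftrightarrow> (\<forall>r\<in>set M. snd (snd (snd r)) \<in> {-1, 0, 1})"

definition tm_halted :: "tm \<Rightarrow> config \<Rightarrow> bool" where
  "tm_halted M c = (case c of (q, tp, h) \<Rightarrow> map_of M (q, tp h) = None)"

definition tm_step :: "tm \<Rightarrow> config \<Rightarrow> config" where
  "tm_step M c = (case c of (q, tp, h) \<Rightarrow>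
     (case map_of M (q, tp h) of
        None \<Rightarrow> (q, tp, h)
      | Some (q', b, d) \<Rightarrow> (q', tp(h := b), h + d)))"

definition tm_run :: "tm \<Rightarrow> nat \<Rightarrow> config \<Rightarrow> config" where
  "tm_run M t c = (tm_step M ^^ t) c"

text \<open>Initial configuration on input word w (input symbols should be nonzero).\<close>
definition tm_init :: "nat list \<Rightarrow> config" where
  "tm_init w = (0, (\<lambda>i. if 0 \<le> i \<and> i < int (length w) then w ! nat i else 0), 0)"

definition tm_computable :: "(nat \<Rightarrow> nat) \<Rightarrow> bool" where
  "tm_computable f \<longleftrightarrow> (\<exists>M. wf_tm M \<and> (\<forall>k. \<exists>t.
      (let (q, tp, h) = tm_run M t (tm_init (replicate k 1)) in
         tm_halted M (q, tp, h) \<and> (\<forall>i::int. 0 \<le> i \<and> i < int (f k) \<longrightarrow> tp i = 1)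
         \<and> tp (int (f k)) = 0)))"

text \<open>An NFA: number of states n (states are 0..<n), transition list of triples
  (p, a, q), initial state, list of final states. The alphabet is {0..<k}.\<close>
type_synonym nfa = "nat \<times> (nat \<times> nat \<times> nat) list \<times> nat \<times> nat list"

definition alphabet :: "nat \<Rightarrow> nat set" where
  "alphabet k = {0..<k}"

definition wf_nfa :: "nat \<Rightarrow> nfa \<Rightarrow> bool" where
  "wf_nfa k A = (case A of (n, \<delta>, q0, F) \<Rightarrow>
     q0 < n \<and> (\<forall>(p, a, q)\<in>set \<delta>. p < n \<and> a < k \<and> q < n) \<and> (\<forall>p\<in>set F. p < n))"

fun nfa_path :: "(nat \<times> nat \<times> nat) list \<Rightarrow> nat \<Rightarrow> nat list \<Rightarrow> nat \<Rightarrow> bool" where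
  "nfa_path \<delta> q [] p = (q = p)"
| "nfa_path \<delta> q (a # w) p = (\<exists>q'. (q, a, q') \<in> set \<delta> \<and> nfa_path \<delta> q' w p)"

definition nfa_lang_from :: "nfa \<Rightarrow> nat \<Rightarrow> nat set \<Rightarrow> nat list set" where
  "nfa_lang_from A q P = (case A of (n, \<delta>, q0, F) \<Rightarrow> {w. \<exists>p\<in>P. nfa_path \<delta> q w p})"

definition nfa_lang :: "nfa \<Rightarrow> nat list set" where
  "nfa_lang A = (case A of (n, \<delta>, q0, F) \<Rightarrow> nfa_lang_from A q0 (set F))"

definition conc :: "'a list set \<Rightarrow> 'a list set \<Rightarrow> 'a list set" where
  "conc A B = {u @ v | u v. u \<in> A \<and> v \<in> B}"

inductive star_free :: "'a set \<Rightarrow> 'a list set \<Rightarrow> bool" for \<Sigma> where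
  sf_finite: "finite L \<Longrightarrow> L \<subseteq> lists \<Sigma> \<Longrightarrow> star_free \<Sigma> L"
| sf_union: "star_free \<Sigma> A \<Longrightarrow> star_free \<Sigma> B \<Longrightarrow> star_free \<Sigma> (A \<union> B)"
| sf_conc: "star_free \<Sigma> A \<Longrightarrow> star_free \<Sigma> B \<Longrightarrow> star_free \<Sigma> (conc A B)"
| sf_compl: "star_free \<Sigma> A \<Longrightarrow> star_free \<Sigma> (lists \<Sigma> - A)"

definition commutative_lang :: "'a list set \<Rightarrow> bool" where
  "commutative_lang L \<longleftrightarrow> (\<forall>u v a b. u @ [a, b] @ v \<in> L \<longrightarrow> u @ [b, a] @ v \<in> L)"

definition totally_star_free :: "nat \<Rightarrow> nfa \<Rightarrow> bool" where
  "totally_star_free k A = (case A of (n, \<delta>, q0, F) \<Rightarrow>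
     (\<forall>q<n. \<forall>p<n. star_free (alphabet k) (nfa_lang_from A q {p})))"

text \<open>An instance: alphabet size k and the list of NFAs A_1..A_m. It satisfies the
  promise if every NFA is well-formed over {0..<k}, totally star-free, and accepts a
  star-free commutative language.\<close>
type_synonym inst = "nat \<times> nfa list"

definition promise :: "inst \<Rightarrow> bool" where
  "promise I = (case I of (k, As) \<Rightarrow> (\<forall>A\<in>set As.
     wf_nfa k A \<and> totally_star_free k A \<and> star_free (alphabet k) (nfa_lang A)
     \<and> commutative_lang (nfa_lang A)))"

definition intersection_nonempty :: "inst \<Rightarrow> bool" where
  "intersection_nonempty I = (case I of (k, As) \<Rightarrow>
     (\<exists>w\<in>lists (alphabet k). \<forall>A\<in>set As. w \<in> nfa_lang A))"

definition enc_nat :: "nat \<Rightarrow> nat list" where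
  "enc_nat n = replicate n 1 @ [2]"

definition enc_nfa :: "nfa \<Rightarrow> nat list" where
  "enc_nfa A = (case A of (n, \<delta>, q0, F) \<Rightarrow>
     enc_nat n @ enc_nat q0 @ concat (map (\<lambda>(p, a, q). enc_nat p @ enc_nat a @ enc_nat q) \<delta>)
     @ [3] @ concat (map enc_nat F) @ [3])"

definition enc_instance :: "inst \<Rightarrow> nat list" where
  "enc_instance I = (case I of (k, As) \<Rightarrow> enc_nat k @ concat (map enc_nfa As))"

end

theory Submission
  imports Defs "HOL-Library.Multiset"
begin

text \<open>For a totally star-free automaton with n states and a letter a, the language of a-powers
  leading from one state to another is, from length 2 * n^2 on, empty or everything: a long walk
  contains a cycle, aperiodicity of the loop languages yields all large lengths, and shortening
  modulo the cycle length brings the threshold down. Since the accepted languages are commutative,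
  a common word may be sorted and its letter counts capped below D = 2 * N^2, which leaves D^k
  candidates, enumerated as k-digit numbers in base D. The machine is obtained by compiling a
  while-program over pointers to tape positions and sets of positions; numbers are kept in
  unary as pointer positions, so all of them may grow to D^k.\<close>

section \<open>Structured programs on a tape\<close>

text \<open>The index that aperiodicity provides stems from a star-free expression and is unrelated
  to the number of states. It is used only qualitatively: it says that from some length on closed
  walks at a state exist always or never. The threshold 2 * n^2 comes from a pigeonhole argument on
  walks. Commutativity is known for the accepted languages, not for the languages between states. It
  is spent once, to sort the common word; after that each block of a letter is capped between the
  two states that enclose it, with one cap for all automata. The input is in unary, so its length N
  exceeds every number of states. Every candidate accepted by all automata is a witness, so
  overshooting D^k does no harm, and D^k is never computed: a candidate is too large when a quotient
  remains after k digits are removed. Unary arithmetic costs as much as the size of the numbers, but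
  these stay polynomial in D^(k + 1), so only the constants in the exponent grow.\<close>

datatype tcom =
    Act "nat \<Rightarrow> nat" int
  | TSeq tcom tcom
  | TIf "nat \<Rightarrow> bool" tcom tcom
  | TWhile "nat \<Rightarrow> bool" tcom

text \<open>The number counts machine steps exactly: one for an action and one for each test, since
  a test is compiled to a rule that only changes the state.\<close>

inductive texec :: "tcom \<Rightarrow> (int \<Rightarrow> nat) \<Rightarrow> int \<Rightarrow> nat \<Rightarrow> (int \<Rightarrow> nat) \<Rightarrow> int \<Rightarrow> bool" where
  texec_Act: "texec (Act g d) tp h 1 (tp(h := g (tp h))) (h + d)"
| texec_Seq: "texec c1 tp h m tp' h' \<Longrightarrow> texec c2 tp' h' n tp'' h''
    \<Longrightarrow> texec (TSeq c1 c2) tp h (m + n) tp'' h''"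
| texec_IfT: "P (tp h) \<Longrightarrow> texec c1 tp h n tp' h' \<Longrightarrow> texec (TIf P c1 c2) tp h (Suc n) tp' h'"
| texec_IfF: "\<not> P (tp h) \<Longrightarrow> texec c2 tp h n tp' h' \<Longrightarrow> texec (TIf P c1 c2) tp h (Suc n) tp' h'"
| texec_WhileF: "\<not> P (tp h) \<Longrightarrow> texec (TWhile P c) tp h 1 tp h"
| texec_WhileT: "P (tp h) \<Longrightarrow> texec c tp h m tp' h' \<Longrightarrow> texec (TWhile P c) tp' h' n tp'' h''
    \<Longrightarrow> texec (TWhile P c) tp h (Suc (m + n)) tp'' h''"

fun tsize :: "tcom \<Rightarrow> nat" where
  "tsize (Act g d) = 1"
| "tsize (TSeq c1 c2) = tsize c1 + tsize c2"
| "tsize (TIf P c1 c2) = 1 + tsize c1 + tsize c2"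
| "tsize (TWhile P c) = 1 + tsize c"

fun tcom_wf :: "nat \<Rightarrow> tcom \<Rightarrow> bool" where
  "tcom_wf X (Act g d) \<longleftrightarrow> (\<forall>x<X. g x < X) \<and> d \<in> {-1, 0, 1}"
| "tcom_wf X (TSeq c1 c2) \<longleftrightarrow> tcom_wf X c1 \<and> tcom_wf X c2"
| "tcom_wf X (TIf P c1 c2) \<longleftrightarrow> tcom_wf X c1 \<and> tcom_wf X c2"
| "tcom_wf X (TWhile P c) \<longleftrightarrow> tcom_wf X c"

text \<open>The code of a command entered in state s occupies the states from s to
  s + tsize c - 1 and leaves in state e; X bounds the symbols.\<close>

fun rules :: "nat \<Rightarrow> tcom \<Rightarrow> nat \<Rightarrow> nat \<Rightarrow> tm" where
  "rules X (Act g d) s e = map (\<lambda>x. ((s, x), (e, g x, d))) [0..<X]"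
| "rules X (TSeq c1 c2) s e = rules X c1 s (s + tsize c1) @ rules X c2 (s + tsize c1) e"
| "rules X (TIf P c1 c2) s e =
     map (\<lambda>x. ((s, x), (if P x then s + 1 else s + 1 + tsize c1, x, 0))) [0..<X]
     @ rules X c1 (s + 1) e @ rules X c2 (s + 1 + tsize c1) e"
| "rules X (TWhile P c) s e =
     map (\<lambda>x. ((s, x), (if P x then s + 1 else e, x, 0))) [0..<X] @ rules X c (s + 1) s"

lemma tm_run_add: "tm_run M (m + n) c = tm_run M n (tm_run M m c)"
  by (simp add: tm_run_def funpow_add add.commute[of m])

lemma tm_run_1: "map_of M (q, tp h) = Some (q', b, d) \<Longrightarrow>
  tm_run M (Suc 0) (q, tp, h) = (q', tp(h := b), h + d)"
  by (simp add: tm_run_def tm_step_def)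

lemma tm_run_Suc: "map_of M (q, tp h) = Some (q', b, d) \<Longrightarrow>
  tm_run M (Suc n) (q, tp, h) = tm_run M n (q', tp(h := b), h + d)"
  using tm_run_add[of M 1 n] tm_run_1 by simp

text \<open>Siblings occupy disjoint intervals of states, which is what separates the keys of their
  rules.\<close>

lemma rules_states: "r \<in> set (rules X c s e) \<Longrightarrow> s \<le> fst (fst r) \<and> fst (fst r) < s + tsize c"
proof (induction c arbitrary: s e)
  case (TSeq c1 c2)
  then consider "r \<in> set (rules X c1 s (s + tsize c1))" | "r \<in> set (rules X c2 (s + tsize c1) e)"
    by auto
  then show ?case using TSeq.IH[of s "s + tsize c1"] TSeq.IH(2)[of "s + tsize c1" e] by cases auto
next
  case (TIf P c1 c2)
  then consider "fst (fst r) = s" | "r \<in> set (rules X c1 (s + 1) e)" | "r \<in> set (rules X c2 (s + 1 + tsize c1) e)"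
    by auto
  then show ?case using TIf.IH(1)[of "s + 1" e] TIf.IH(2)[of "s + 1 + tsize c1" e] by cases auto
next
  case (TWhile P c)
  then consider "fst (fst r) = s" | "r \<in> set (rules X c (s + 1) s)"
    by auto
  then show ?case using TWhile.IH(1)[of "s + 1" s] by cases auto
qed auto

lemma distinct_state_keys: "distinct (map (\<lambda>x. (s, x)) [0..<X])"
  by (auto simp: distinct_map inj_on_def)

text \<open>A machine uses the first matching rule. Without repeated keys the order in the list is
  irrelevant and every rule is effective.\<close>

lemma rules_distinct: "distinct (map fst (rules X c s e))"
proof (induction c arbitrary: s e)
  case (Act g d)
  then show ?case using distinct_state_keys by (simp add: comp_def)
next
  case (TSeq c1 c2)
  have "fst ` set (rules X c1 s (s + tsize c1)) \<inter> fst ` set (rules X c2 (s + tsize c1) e) = {}"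
    by (force dest: rules_states)
  then show ?case using TSeq by simp
next
  case (TIf P c1 c2)
  have "fst ` set (rules X c1 (Suc s) e) \<inter> fst ` set (rules X c2 (Suc (s + tsize c1)) e) = {}"
    by (force dest: rules_states)
  moreover have "Pair s ` {0..<X} \<inter> fst ` set (rules X c1 (Suc s) e) = {}"
      "Pair s ` {0..<X} \<inter> fst ` set (rules X c2 (Suc (s + tsize c1)) e) = {}"
    by (auto dest!: rules_states)
  moreover have keys: "map fst (rules X (TIf P c1 c2) s e) =
      map (Pair s) [0..<X] @ map fst (rules X c1 (Suc s) e) @ map fst (rules X c2 (Suc (s + tsize c1)) e)"
    by (simp add: comp_def)
  ultimately show ?case using TIf.IH distinct_state_keys[of s X]
    by (simp only: keys distinct_append set_append set_map Int_Un_distrib set_upt Un_empty)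
next
  case (TWhile P c)
  have "Pair s ` {0..<X} \<inter> fst ` set (rules X c (Suc s) s) = {}"
    by (auto dest!: rules_states)
  moreover have keys: "map fst (rules X (TWhile P c) s e) =
      map (Pair s) [0..<X] @ map fst (rules X c (Suc s) s)"
    by (simp add: comp_def)
  ultimately show ?case using TWhile.IH distinct_state_keys[of s X]
    by (simp only: keys distinct_append set_append set_map set_upt)
qed

lemma rules_wf: "tcom_wf X c \<Longrightarrow> wf_tm (rules X c s e)"
  unfolding wf_tm_def
proof (induction c arbitrary: s e)
  case (TSeq c1 c2)
  then show ?case by (simp add: ball_Un)
next
  case (TIf P c1 c2)
  then show ?case by (simp add: ball_Un)
qed auto

lemma head_rule:
  assumes "x < X"
  shows "((s, x), (if P x then s + 1 else s + 1 + tsize c1, x, 0)) \<in> set (rules X (TIf P c1 c2) s e)"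
    and "((s, x), (if P x then s + 1 else e, x, 0)) \<in> set (rules X (TWhile P c) s e)"
  using assms by auto

text \<open>\<open>M\<close> may be any machine in which the rules of the command are effective.
  This lets the induction descend into subcommands and lets a command be embedded in a larger
  machine. The symbol bound is carried along because there are rules only for symbols below
  \<open>X\<close>.\<close>

lemma rules_run:
  assumes "texec c tp h n tp' h'" and "tcom_wf X c" and "\<forall>i. tp i < X"
    and "\<forall>r \<in> set (rules X c s e). map_of M (fst r) = Some (snd r)"
  shows "tm_run M n (s, tp, h) = (e, tp', h') \<and> (\<forall>i. tp' i < X)"
  using assms
proof (induction arbitrary: s e rule: texec.induct)
  case (texec_Act g d tp h)
  then have "map_of M (s, tp h) = Some (e, g (tp h), d)" by auto
  moreover have "tp i < X" "g (tp i) < X" for i using texec_Act by auto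
  ultimately show ?case by (auto simp: tm_run_1)
next
  case (texec_Seq c1 tp h m tp' h' c2 n tp'' h'')
  have 1: "tm_run M m (s, tp, h) = (s + tsize c1, tp', h') \<and> (\<forall>i. tp' i < X)"
    using texec_Seq.prems by (intro texec_Seq.IH(1)) auto
  have "tm_run M n (s + tsize c1, tp', h') = (e, tp'', h'') \<and> (\<forall>i. tp'' i < X)"
    using texec_Seq.prems 1 by (intro texec_Seq.IH(2)) auto
  then show ?case using 1 by (simp add: tm_run_add)
next
  case (texec_IfT P tp h c1 n tp' h' c2)
  have "map_of M (s, tp h) = Some (s + 1, tp h, 0)"
    using texec_IfT.prems(2) texec_IfT.hyps(1) bspec[OF texec_IfT.prems(3) head_rule(1)] by simp
  moreover have "tm_run M n (s + 1, tp, h) = (e, tp', h') \<and> (\<forall>i. tp' i < X)"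
    using texec_IfT.prems by (intro texec_IfT.IH) auto
  ultimately show ?case by (simp add: tm_run_Suc)
next
  case (texec_IfF P tp h c2 n tp' h' c1)
  have "map_of M (s, tp h) = Some (s + 1 + tsize c1, tp h, 0)"
    using texec_IfF.prems(2) texec_IfF.hyps(1) bspec[OF texec_IfF.prems(3) head_rule(1)] by simp
  moreover have "tm_run M n (s + 1 + tsize c1, tp, h) = (e, tp', h') \<and> (\<forall>i. tp' i < X)"
    using texec_IfF.prems by (intro texec_IfF.IH) auto
  ultimately show ?case by (simp add: tm_run_Suc)
next
  case (texec_WhileF P tp h c)
  have "map_of M (s, tp h) = Some (e, tp h, 0)"
    using texec_WhileF.prems(2) texec_WhileF.hyps(1) bspec[OF texec_WhileF.prems(3) head_rule(2)] by simp
  then show ?case using texec_WhileF by (simp add: tm_run_1)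
next
  case (texec_WhileT P tp h c m tp' h' n tp'' h'')
  have "map_of M (s, tp h) = Some (s + 1, tp h, 0)"
    using texec_WhileT.prems(2) texec_WhileT.hyps(1) bspec[OF texec_WhileT.prems(3) head_rule(2)] by simp
  moreover have 1: "tm_run M m (s + 1, tp, h) = (s, tp', h') \<and> (\<forall>i. tp' i < X)"
    using texec_WhileT.prems by (intro texec_WhileT.IH(1)) auto
  moreover have "tm_run M n (s, tp', h') = (e, tp'', h'') \<and> (\<forall>i. tp'' i < X)"
    using texec_WhileT.prems 1 by (intro texec_WhileT.IH(2)) auto
  ultimately show ?case by (simp add: tm_run_Suc tm_run_add)
qed

lemma rules_run_self:
  assumes "texec c tp h n tp' h'" and "tcom_wf X c" and "\<forall>i. tp i < X"
  shows "tm_run (rules X c s e) n (s, tp, h) = (e, tp', h')"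
proof -
  have "\<forall>r \<in> set (rules X c s e). map_of (rules X c s e) (fst r) = Some (snd r)"
    by (simp add: rules_distinct)
  then show ?thesis using rules_run[OF assms] by blast
qed

section \<open>Pointer programs\<close>

text \<open>A high-level machine manipulates pointers, numbered from 4 to 31, and sets of positions,
  numbered from 0 to 3. On the tape, bit g of a cell says that pointer g is there or that the
  position belongs to set g. Sets 0 and 1 hold the two bits of the input symbols; pointer 4 stays
  at position 0.\<close>

datatype pcom =
    Skip
  | Inc nat
  | Dec nat
  | Copy nat nat
  | Put nat nat
  | Del nat nat
  | PSeq pcom pcom (infixr ";;" 60)
  | PIf "(nat \<Rightarrow> bool) \<Rightarrow> bool" nat pcom pcom
  | PWhile "(nat \<Rightarrow> bool) \<Rightarrow> bool" nat pcom

text \<open>Equality of pointers becomes a local test: bit q of the cell under pointer p says that p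
  and q coincide. The guard \<open>g < 32\<close> clears all higher bits, so symbols stay below
  2^32.\<close>

definition flag :: "(nat \<Rightarrow> nat) \<Rightarrow> (nat \<Rightarrow> nat set) \<Rightarrow> nat \<Rightarrow> nat \<Rightarrow> bool" where
  "flag v A i g \<longleftrightarrow> (if g < 4 then i \<in> A g else g < 32 \<and> v g = i)"

text \<open>At position 0 \<open>Dec\<close> has no derivation, so a derivation certifies that no
  pointer leaves the nonnegative cells.\<close>

inductive pexec :: "pcom \<Rightarrow> (nat \<Rightarrow> nat) \<Rightarrow> (nat \<Rightarrow> nat set) \<Rightarrow> nat \<Rightarrow> (nat \<Rightarrow> nat) \<Rightarrow> (nat \<Rightarrow> nat set) \<Rightarrow> bool" where
  pexec_Skip: "pexec Skip v A 1 v A"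
| pexec_Inc: "pexec (Inc p) v A 1 (v(p := Suc (v p))) A"
| pexec_Dec: "0 < v p \<Longrightarrow> pexec (Dec p) v A 1 (v(p := v p - 1)) A"
| pexec_Copy: "pexec (Copy p q) v A 1 (v(p := v q)) A"
| pexec_Put: "pexec (Put f p) v A 1 v (A(f := insert (v p) (A f)))"
| pexec_Del: "pexec (Del f p) v A 1 v (A(f := A f - {v p}))"
| pexec_Seq: "pexec c1 v A m v' A' \<Longrightarrow> pexec c2 v' A' n v'' A'' \<Longrightarrow> pexec (c1 ;; c2) v A (m + n) v'' A''"
| pexec_IfT: "P (flag v A (v p)) \<Longrightarrow> pexec c1 v A n v' A' \<Longrightarrow> pexec (PIf P p c1 c2) v A (Suc n) v' A'"
| pexec_IfF: "\<not> P (flag v A (v p)) \<Longrightarrow> pexec c2 v A n v' A' \<Longrightarrow> pexec (PIf P p c1 c2) v A (Suc n) v' A'"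
| pexec_WhileF: "\<not> P (flag v A (v p)) \<Longrightarrow> pexec (PWhile P p c) v A 1 v A"
| pexec_WhileT: "P (flag v A (v p)) \<Longrightarrow> pexec c v A m v' A' \<Longrightarrow> pexec (PWhile P p c) v' A' n v'' A''
    \<Longrightarrow> pexec (PWhile P p c) v A (Suc (m + n)) v'' A''"

abbreviation is_ptr :: "nat \<Rightarrow> bool" where
  "is_ptr p \<equiv> 4 \<le> p \<and> p < 32"

text \<open>Pointer 4 is never moved, as it marks the origin for \<open>seek\<close>. In
  \<open>Copy\<close> the pointers differ because the mark of p is erased before q is sought; with p
  = q the search would not end.\<close>

fun pcom_wf :: "pcom \<Rightarrow> bool" where
  "pcom_wf Skip \<longleftrightarrow> True"
| "pcom_wf (Inc p) \<longleftrightarrow> 4 < p \<and> p < 32"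
| "pcom_wf (Dec p) \<longleftrightarrow> 4 < p \<and> p < 32"
| "pcom_wf (Copy p q) \<longleftrightarrow> 4 < p \<and> p < 32 \<and> is_ptr q \<and> p \<noteq> q"
| "pcom_wf (Put f p) \<longleftrightarrow> f < 4 \<and> is_ptr p"
| "pcom_wf (Del f p) \<longleftrightarrow> f < 4 \<and> is_ptr p"
| "pcom_wf (c1 ;; c2) \<longleftrightarrow> pcom_wf c1 \<and> pcom_wf c2"
| "pcom_wf (PIf P p c1 c2) \<longleftrightarrow> is_ptr p \<and> pcom_wf c1 \<and> pcom_wf c2"
| "pcom_wf (PWhile P p c) \<longleftrightarrow> is_ptr p \<and> pcom_wf c"

text \<open>The head may be on either side of the pointer. Seen from the origin, the pointer is
  never to the left, so returning to mark 4 settles the direction.\<close>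

definition seek :: "nat \<Rightarrow> tcom" where
  "seek p = TSeq (TWhile (\<lambda>x. \<not> bit x 4) (Act (\<lambda>x. x) (-1)))
                 (TWhile (\<lambda>x. \<not> bit x p) (Act (\<lambda>x. x) 1))"

fun tape_code :: "pcom \<Rightarrow> tcom" where
  "tape_code Skip = Act (\<lambda>x. x) 0"
| "tape_code (Inc p) = TSeq (seek p) (TSeq (Act (unset_bit p) 1) (Act (set_bit p) 0))"
| "tape_code (Dec p) = TSeq (seek p) (TSeq (Act (unset_bit p) (-1)) (Act (set_bit p) 0))"
| "tape_code (Copy p q) = TSeq (seek p) (TSeq (Act (unset_bit p) 0) (TSeq (seek q) (Act (set_bit p) 0)))"
| "tape_code (Put f p) = TSeq (seek p) (Act (set_bit f) 0)"
| "tape_code (Del f p) = TSeq (seek p) (Act (unset_bit f) 0)"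
| "tape_code (c1 ;; c2) = TSeq (tape_code c1) (tape_code c2)"
| "tape_code (PIf P p c1 c2) = TSeq (seek p) (TIf (\<lambda>x. P (bit x)) (tape_code c1) (tape_code c2))"
| "tape_code (PWhile P p c) = TSeq (seek p) (TWhile (\<lambda>x. P (bit x)) (TSeq (tape_code c) (seek p)))"

definition represents :: "(int \<Rightarrow> nat) \<Rightarrow> (nat \<Rightarrow> nat) \<Rightarrow> (nat \<Rightarrow> nat set) \<Rightarrow> bool" where
  "represents tp v A \<longleftrightarrow> v 4 = 0 \<and> (\<forall>i g. bit (tp (int i)) g \<longleftrightarrow> flag v A i g)"

lemma nat_less_exp_iff_bit: "(x::nat) < 2 ^ n \<longleftrightarrow> (\<forall>g\<ge>n. \<not> bit x g)"
proof
  assume less: "x < 2 ^ n"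
  show "\<forall>g\<ge>n. \<not> bit x g"
  proof (intro allI impI)
    fix g assume "g \<ge> n"
    then have "(2::nat) ^ n \<le> 2 ^ g" by (intro power_increasing) simp_all
    then have "x div 2 ^ g = 0" using less by (intro div_less) linarith
    then show "\<not> bit x g" by (simp only: bit_iff_odd) simp
  qed
next
  assume bits: "\<forall>g\<ge>n. \<not> bit x g"
  have "take_bit n x = x"
  proof (rule bit_eqI)
    fix g show "bit (take_bit n x) g \<longleftrightarrow> bit x g"
      using bits by (cases "g < n") (simp_all only: bit_take_bit_iff not_less, blast+)
  qed
  then show "x < 2 ^ n" by (simp only: take_bit_nat_eq_self_iff)
qed

text \<open>A separate constant keeps the simplifier from unfolding lists of this length.\<close>

definition num_symbols :: nat where
  "num_symbols = 2 ^ 32"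

lemma less_num_symbols_iff: "x < num_symbols \<longleftrightarrow> (\<forall>g\<ge>32. \<not> bit x g)"
  unfolding num_symbols_def by (rule nat_less_exp_iff_bit)

lemma tape_code_wf: "pcom_wf c \<Longrightarrow> tcom_wf num_symbols (tape_code c)"
proof -
  have "tcom_wf num_symbols (seek p)" for p by (simp add: seek_def)
  moreover have "set_bit p x < num_symbols" "unset_bit p x < num_symbols" if "p < 32" "x < num_symbols" for p x :: nat
    using that by (auto simp only: less_num_symbols_iff bit_set_bit_iff bit_unset_bit_iff)
  ultimately show "pcom_wf c \<Longrightarrow> tcom_wf num_symbols (tape_code c)"
    by (induction c) (auto)
qed

text \<open>While a pointer moves, its mark is missing and the tape represents no state. This weaker
  property still supports \<open>seek\<close> during that gap.\<close>

definition marks :: "(int \<Rightarrow> nat) \<Rightarrow> nat \<Rightarrow> nat \<Rightarrow> bool" where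
  "marks tp p m \<longleftrightarrow> (\<forall>i. bit (tp (int i)) p \<longleftrightarrow> i = m)"

lemma texec_seek_left:
  assumes "marks tp 4 0"
  shows "texec (TWhile (\<lambda>x. \<not> bit x 4) (Act (\<lambda>x. x) (-1))) tp (int i) (2 * i + 1) tp 0"
proof (induction i)
  case 0
  have "bit (tp (int 0)) 4" using assms unfolding marks_def by blast
  then show ?case using texec_WhileF[of "\<lambda>x. \<not> bit x 4" tp 0] by simp
next
  case (Suc i)
  have "\<not> bit (tp (int (Suc i))) 4" using assms unfolding marks_def by blast
  moreover have "texec (Act (\<lambda>x. x) (-1)) tp (int (Suc i)) 1 tp (int i)"
    using texec_Act[of "\<lambda>x. x" "-1" tp "int (Suc i)"] by simp
  ultimately have "texec (TWhile (\<lambda>x. \<not> bit x 4) (Act (\<lambda>x. x) (-1))) tp (int (Suc i)) (Suc (1 + (2 * i + 1))) tp 0"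
    using Suc by (intro texec_WhileT) blast+
  then show ?case by simp
qed

lemma texec_seek_right:
  assumes "marks tp p m" and "i \<le> m"
  shows "texec (TWhile (\<lambda>x. \<not> bit x p) (Act (\<lambda>x. x) 1)) tp (int i) (2 * (m - i) + 1) tp (int m)"
  using assms(2)
proof (induction "m - i" arbitrary: i)
  case 0
  then have "bit (tp (int i)) p" "i = m" using assms(1) by (auto simp: marks_def)
  then show ?case using texec_WhileF[of "\<lambda>x. \<not> bit x p" tp "int i"] by simp
next
  case (Suc n)
  then have "i < m" by simp
  then have "\<not> bit (tp (int i)) p" using assms(1) by (simp add: marks_def)
  moreover have "texec (Act (\<lambda>x. x) 1) tp (int i) 1 tp (int (Suc i))"
    using texec_Act[of "\<lambda>x. x" "1" tp "int i"] by (simp add: algebra_simps)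
  moreover have "texec (TWhile (\<lambda>x. \<not> bit x p) (Act (\<lambda>x. x) 1)) tp (int (Suc i)) (2 * (m - Suc i) + 1) tp (int m)"
    using Suc \<open>i < m\<close> by (intro Suc.hyps) auto
  ultimately have "texec (TWhile (\<lambda>x. \<not> bit x p) (Act (\<lambda>x. x) 1)) tp (int i)
      (Suc (1 + (2 * (m - Suc i) + 1))) tp (int m)"
    by (intro texec_WhileT)
  moreover have "Suc (1 + (2 * (m - Suc i) + 1)) = 2 * (m - i) + 1" using \<open>i < m\<close> by simp
  ultimately show ?case by simp
qed

lemma texec_seek:
  assumes "marks tp 4 0" and "marks tp p m" and "0 \<le> h"
  shows "texec (seek p) tp h (2 * nat h + 1 + (2 * m + 1)) tp (int m)"
  using texec_Seq[OF texec_seek_left[OF assms(1), of "nat h"] texec_seek_right[OF assms(2), of 0, simplified]]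
    assms(3) by (simp add: seek_def)

lemma represents_marks:
  assumes "represents tp v A" and "is_ptr p"
  shows "marks tp p (v p)" "marks tp 4 0"
  using assms by (auto simp: represents_def marks_def flag_def)

text \<open>The target j is arbitrary, so one statement serves \<open>Inc\<close>,
  \<open>Dec\<close> and \<open>Copy\<close>.\<close>

lemma represents_move:
  assumes "represents tp v A" and "4 < p" "p < 32"
    and "tp1 = tp(int (v p) := unset_bit p (tp (int (v p))))"
  shows "represents (tp1(int j := set_bit p (tp1 (int j)))) (v(p := j)) A"
    and "marks tp1 4 0" and "is_ptr q \<Longrightarrow> q \<noteq> p \<Longrightarrow> marks tp1 q (v q)"
proof -
  have tp1: "bit (tp1 (int i)) g \<longleftrightarrow> flag v A i g \<and> g \<noteq> p" for i g
    using assms by (auto simp: represents_def flag_def bit_unset_bit_iff)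
  then show "marks tp1 4 0" "is_ptr q \<Longrightarrow> q \<noteq> p \<Longrightarrow> marks tp1 q (v q)"
    using assms by (auto simp: represents_def marks_def flag_def)
  show "represents (tp1(int j := set_bit p (tp1 (int j)))) (v(p := j)) A"
    using tp1 assms(1-3) by (auto simp: represents_def flag_def bit_set_bit_iff)
qed

lemma represents_Put:
  assumes "represents tp v A" and "f < 4"
  shows "represents (tp(int i := set_bit f (tp (int i)))) v (A(f := insert i (A f)))"
  using assms by (auto simp: represents_def flag_def bit_set_bit_iff)

lemma represents_Del:
  assumes "represents tp v A" and "f < 4"
  shows "represents (tp(int i := unset_bit f (tp (int i)))) v (A(f := A f - {i}))"
  using assms by (auto simp: represents_def flag_def bit_unset_bit_iff)

text \<open>m bounds the head position and all pointers; this bound grows by at most one per step.\<close>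

definition within :: "(int \<Rightarrow> nat) \<Rightarrow> int \<Rightarrow> (nat \<Rightarrow> nat) \<Rightarrow> (nat \<Rightarrow> nat set) \<Rightarrow> nat \<Rightarrow> bool" where
  "within tp h v A m \<longleftrightarrow>
     represents tp v A \<and> 0 \<le> h \<and> h \<le> int m \<and> (\<forall>p. is_ptr p \<longrightarrow> v p \<le> m)"

text \<open>All positions stay at most m + n during n program steps. One program step needs at most
  two seeks of 4 * (m + n) + 2 tape steps each and a constant number of further ones.\<close>

definition cost :: "nat \<Rightarrow> nat \<Rightarrow> nat" where
  "cost m n = n * (8 * (m + n) + 10)"

lemma cost_simps: "cost m 1 = 8 * m + 18"
  "cost m a + cost (m + a) b \<le> cost m (a + b)"
  "8 * m + 8 + cost m n \<le> cost m (Suc n)"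
  by (auto simp: cost_def algebra_simps)

lemma within_seek:
  assumes "within tp h v A m" and "is_ptr p"
  shows "\<exists>n \<le> 4 * m + 2. texec (seek p) tp h n tp (int (v p))"
proof (intro exI conjI)
  show "texec (seek p) tp h (2 * nat h + 1 + (2 * v p + 1)) tp (int (v p))"
    using assms represents_marks[of tp v A p] by (intro texec_seek) (auto simp: within_def)
  have "nat h \<le> m" "v p \<le> m" using assms by (auto simp: within_def)
  then show "2 * nat h + 1 + (2 * v p + 1) \<le> 4 * m + 2" by simp
qed

lemma within_update:
  assumes "within tp h v A m" and "represents tp' (v(p := x)) A'" and "x \<le> m + 1"
  shows "within tp' (int x) (v(p := x)) A' (m + 1)"
  using assms by (auto simp: within_def le_SucI)

lemma texec_Act': "h' = h + d \<Longrightarrow> tp' = tp(h := g (tp h)) \<Longrightarrow> texec (Act g d) tp h 1 tp' h'"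
  using texec_Act by simp

lemma tape_code_exec:
  assumes "pexec c v A n v' A'" and "pcom_wf c" and "within tp h v A m"
  shows "\<exists>n' tp' h'. n' \<le> cost m n \<and> texec (tape_code c) tp h n' tp' h' \<and> within tp' h' v' A' (m + n)"
  using assms
proof (induction arbitrary: tp h m rule: pexec.induct)
  case (pexec_Skip v A)
  have "texec (tape_code Skip) tp h 1 tp h" using texec_Act[of "\<lambda>x. x" 0 tp h] by simp
  moreover have "within tp h v A (m + 1)" using pexec_Skip.prems by (auto simp: within_def le_SucI)
  moreover have "1 \<le> cost m 1" unfolding cost_simps by simp
  ultimately show ?case by blast
next
  case (pexec_Inc p v A)
  let ?i = "int (v p)"
  let ?tp1 = "tp(?i := unset_bit p (tp ?i))"
  let ?tp2 = "?tp1(int (Suc (v p)) := set_bit p (?tp1 (int (Suc (v p)))))"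
  obtain n where n: "n \<le> 4 * m + 2" "texec (seek p) tp h n tp ?i"
    using within_seek[of tp h v A m p] pexec_Inc by auto
  have "int (Suc (v p)) = ?i + 1" by simp
  then have run: "texec (tape_code (Inc p)) tp h (n + (1 + 1)) ?tp2 (int (Suc (v p)))"
    unfolding tape_code.simps by (intro texec_Seq[OF n(2)] texec_Seq texec_Act') (auto simp del: of_nat_Suc)
  have "represents ?tp2 (v(p := Suc (v p))) A"
    using pexec_Inc by (intro represents_move) (auto simp: within_def)
  then have "within ?tp2 (int (Suc (v p))) (v(p := Suc (v p))) A (m + 1)"
    using pexec_Inc.prems by (auto simp: within_def)
  moreover have "n + (1 + 1) \<le> cost m 1" using n(1) unfolding cost_simps by simp
  ultimately show ?case using run by blast
next
  case (pexec_Dec v p A)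
  let ?i = "int (v p)"
  let ?tp1 = "tp(?i := unset_bit p (tp ?i))"
  let ?tp2 = "?tp1(int (v p - 1) := set_bit p (?tp1 (int (v p - 1))))"
  obtain n where n: "n \<le> 4 * m + 2" "texec (seek p) tp h n tp ?i"
    using within_seek[of tp h v A m p] pexec_Dec by auto
  have "int (v p - 1) = ?i + -1" using pexec_Dec by simp
  then have run: "texec (tape_code (Dec p)) tp h (n + (1 + 1)) ?tp2 (int (v p - 1))"
    unfolding tape_code.simps by (intro texec_Seq[OF n(2)] texec_Seq texec_Act') auto
  have "represents ?tp2 (v(p := v p - 1)) A"
    using pexec_Dec by (intro represents_move) (auto simp: within_def)
  moreover have "v p \<le> m" using pexec_Dec.prems by (auto simp: within_def)
  ultimately have "within ?tp2 (int (v p - 1)) (v(p := v p - 1)) A (m + 1)"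
    using pexec_Dec.prems by (intro within_update) auto
  moreover have "n + (1 + 1) \<le> cost m 1" using n(1) unfolding cost_simps by simp
  ultimately show ?case using run by blast
next
  case (pexec_Copy p q v A)
  let ?i = "int (v p)"
  let ?tp1 = "tp(?i := unset_bit p (tp ?i))"
  let ?tp2 = "?tp1(int (v q) := set_bit p (?tp1 (int (v q))))"
  let ?k = "2 * nat ?i + 1 + (2 * v q + 1)"
  obtain n where n: "n \<le> 4 * m + 2" "texec (seek p) tp h n tp ?i"
    using within_seek[of tp h v A m p] pexec_Copy by auto
  have r: "represents ?tp2 (v(p := v q)) A" and m: "marks ?tp1 4 0" "marks ?tp1 q (v q)"
    using pexec_Copy.prems represents_move[where tp = tp and v = v and A = A and p = p and ?tp1.0 = ?tp1]
    by (simp_all add: within_def del: fun_upd_apply)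
  have "texec (seek q) ?tp1 ?i ?k ?tp1 (int (v q))"
    by (intro texec_seek m) auto
  then have run: "texec (tape_code (Copy p q)) tp h (n + (1 + (?k + 1))) ?tp2 (int (v q))"
    unfolding tape_code.simps by (intro texec_Seq[OF n(2)]) (rule texec_Seq texec_Act' | simp)+
  have "v p \<le> m" "v q \<le> m" using pexec_Copy by (auto simp: within_def)
  then have "n + (1 + (?k + 1)) \<le> cost m 1" using n(1) unfolding cost_simps by simp
  moreover have "within ?tp2 (int (v q)) (v(p := v q)) A (m + 1)"
    using pexec_Copy.prems r \<open>v q \<le> m\<close> by (intro within_update) auto
  ultimately show ?case using run by blast
next
  case (pexec_Put f p v A)
  let ?i = "int (v p)"
  obtain n where n: "n \<le> 4 * m + 2" "texec (seek p) tp h n tp ?i"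
    using within_seek[of tp h v A m p] pexec_Put by auto
  have run: "texec (tape_code (Put f p)) tp h (n + 1) (tp(?i := set_bit f (tp ?i))) ?i"
    unfolding tape_code.simps by (intro texec_Seq[OF n(2)] texec_Act') auto
  have "represents (tp(?i := set_bit f (tp ?i))) v (A(f := insert (v p) (A f)))"
    using pexec_Put by (intro represents_Put) (auto simp: within_def)
  then have "within (tp(?i := set_bit f (tp ?i))) (?i) v (A(f := insert (v p) (A f))) (m + 1)"
    using pexec_Put.prems by (auto simp: within_def)
  moreover have "n + 1 \<le> cost m 1" using n(1) unfolding cost_simps by simp
  ultimately show ?case using run by blast
next
  case (pexec_Del f p v A)
  let ?i = "int (v p)"
  obtain n where n: "n \<le> 4 * m + 2" "texec (seek p) tp h n tp ?i"
    using within_seek[of tp h v A m p] pexec_Del by auto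
  have run: "texec (tape_code (Del f p)) tp h (n + 1) (tp(?i := unset_bit f (tp ?i))) ?i"
    unfolding tape_code.simps by (intro texec_Seq[OF n(2)] texec_Act') auto
  have "represents (tp(?i := unset_bit f (tp ?i))) v (A(f := A f - {v p}))"
    using pexec_Del by (intro represents_Del) (auto simp: within_def)
  then have "within (tp(?i := unset_bit f (tp ?i))) (?i) v (A(f := A f - {v p})) (m + 1)"
    using pexec_Del.prems by (auto simp: within_def)
  moreover have "n + 1 \<le> cost m 1" using n(1) unfolding cost_simps by simp
  ultimately show ?case using run by blast
next
  case (pexec_Seq c1 v A a v' A' c2 b v'' A'')
  obtain n1 tp1 h1 where 1: "n1 \<le> cost m a" "texec (tape_code c1) tp h n1 tp1 h1" "within tp1 h1 v' A' (m + a)"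
    using pexec_Seq by (metis pcom_wf.simps(7))
  obtain n2 tp2 h2 where 2: "n2 \<le> cost (m + a) b" "texec (tape_code c2) tp1 h1 n2 tp2 h2" "within tp2 h2 v'' A'' (m + a + b)"
    using pexec_Seq.IH(2)[OF _ 1(3)] pexec_Seq.prems by auto
  show ?case using 1 2 cost_simps(2)[of m a b]
    by (intro exI[of _ "n1 + n2"] exI[of _ tp2] exI[of _ h2]) (auto intro: texec_Seq simp: add.assoc)
next
  case (pexec_IfT P v A p c1 n v' A' c2)
  obtain k where k: "k \<le> 4 * m + 2" "texec (seek p) tp h k tp (int (v p))"
    using within_seek[of tp h v A m p] pexec_IfT by auto
  have "within tp (int (v p)) v A m" using pexec_IfT by (auto simp: within_def)
  then obtain n1 tp1 h1 where 1: "n1 \<le> cost m n" "texec (tape_code c1) tp (int (v p)) n1 tp1 h1" "within tp1 h1 v' A' (m + n)"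
    using pexec_IfT by (metis pcom_wf.simps(8))
  have "bit (tp (int (v p))) = flag v A (v p)" using pexec_IfT by (auto simp: within_def represents_def)
  then have "texec (tape_code (PIf P p c1 c2)) tp h (k + Suc n1) tp1 h1"
    unfolding tape_code.simps using pexec_IfT by (intro texec_Seq[OF k(2)] texec_IfT 1) auto
  then show ?case using 1 k(1) cost_simps(3)[of m n]
    by (intro exI[of _ "k + Suc n1"] exI[of _ tp1] exI[of _ h1]) (auto simp: within_def)
next
  case (pexec_IfF P v A p c2 n v' A' c1)
  obtain k where k: "k \<le> 4 * m + 2" "texec (seek p) tp h k tp (int (v p))"
    using within_seek[of tp h v A m p] pexec_IfF by auto
  have "within tp (int (v p)) v A m" using pexec_IfF by (auto simp: within_def)
  then obtain n1 tp1 h1 where 1: "n1 \<le> cost m n" "texec (tape_code c2) tp (int (v p)) n1 tp1 h1" "within tp1 h1 v' A' (m + n)"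
    using pexec_IfF by (metis pcom_wf.simps(8))
  have "bit (tp (int (v p))) = flag v A (v p)" using pexec_IfF by (auto simp: within_def represents_def)
  then have "texec (tape_code (PIf P p c1 c2)) tp h (k + Suc n1) tp1 h1"
    unfolding tape_code.simps using pexec_IfF by (intro texec_Seq[OF k(2)] texec_IfF 1) auto
  then show ?case using 1 k(1) cost_simps(3)[of m n]
    by (intro exI[of _ "k + Suc n1"] exI[of _ tp1] exI[of _ h1]) (auto simp: within_def)
next
  case (pexec_WhileF P v A p c)
  obtain k where k: "k \<le> 4 * m + 2" "texec (seek p) tp h k tp (int (v p))"
    using within_seek[of tp h v A m p] pexec_WhileF by auto
  have "bit (tp (int (v p))) = flag v A (v p)" using pexec_WhileF by (auto simp: within_def represents_def)
  then have "texec (tape_code (PWhile P p c)) tp h (k + 1) tp (int (v p))"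
    unfolding tape_code.simps using pexec_WhileF by (intro texec_Seq[OF k(2)] texec_WhileF) auto
  then show ?case using k(1) pexec_WhileF cost_simps(1)
    by (intro exI[of _ "k + 1"] exI[of _ tp] exI[of _ "int (v p)"]) (force simp: within_def)
next
  case (pexec_WhileT P v A p c a v' A' b v'' A'')
  obtain k where k: "k \<le> 4 * m + 2" "texec (seek p) tp h k tp (int (v p))"
    using within_seek[of tp h v A m p] pexec_WhileT by auto
  have "within tp (int (v p)) v A m" using pexec_WhileT by (auto simp: within_def)
  then obtain n1 tp1 h1 where 1: "n1 \<le> cost m a" "texec (tape_code c) tp (int (v p)) n1 tp1 h1" "within tp1 h1 v' A' (m + a)"
    using pexec_WhileT by (metis pcom_wf.simps(9))
  obtain n2 tp2 h2 where 2: "n2 \<le> cost (m + a) b" "texec (tape_code (PWhile P p c)) tp1 h1 n2 tp2 h2"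
      "within tp2 h2 v'' A'' (m + a + b)"
    using pexec_WhileT.IH(2)[OF _ 1(3)] pexec_WhileT.prems by auto
  \<comment> \<open>The code of a loop starts with a seek, and inside the tape loop the same seek
    ends the body. So the run of the remaining loop is cut after its seek, which becomes the end of
    the first round.\<close>
  obtain x y tp3 h3 where 3: "n2 = x + y" "texec (seek p) tp1 h1 x tp3 h3"
      "texec (TWhile (\<lambda>x. P (bit x)) (TSeq (tape_code c) (seek p))) tp3 h3 y tp2 h2"
    using 2(2) by (auto elim: texec.cases)
  have "bit (tp (int (v p))) = flag v A (v p)" using pexec_WhileT by (auto simp: within_def represents_def)
  then have "texec (tape_code (PWhile P p c)) tp h (k + Suc (n1 + x + y)) tp2 h2"
    unfolding tape_code.simps using pexec_WhileT.hyps(1)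
    by (intro texec_Seq[OF k(2)] texec_WhileT[OF _ texec_Seq[OF 1(2) 3(2)] 3(3)]) auto
  moreover have "k + Suc (n1 + x + y) \<le> cost m (Suc (a + b))"
    using k(1) 1(1) 2(1) 3(1) cost_simps(2)[of m a b] cost_simps(3)[of m "a + b"] by linarith
  moreover have "within tp2 h2 v'' A'' (m + Suc (a + b))"
    using 2(3) by (auto simp: within_def)
  ultimately show ?case by blast
qed

section \<open>The Turing machine of a pointer program\<close>

definition input_sets :: "nat list \<Rightarrow> nat \<Rightarrow> nat set" where
  "input_sets w f = {i. i < length w \<and> bit (w ! i) f}"

definition tape_of :: "nat list \<Rightarrow> int \<Rightarrow> nat" where
  "tape_of w i = (if 0 \<le> i \<and> i < int (length w) then w ! nat i else 0)"

lemma tm_init_eq: "tm_init w = (0, tape_of w, 0)"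
  by (auto simp: tm_init_def tape_of_def)

text \<open>The second operand consists of bits 4 to 31: all 28 pointers are put in the scanned
  cell, and the input bits 0 and 1 survive.\<close>

definition place_pointers :: "nat \<Rightarrow> nat" where
  "place_pointers x = or x (push_bit 4 (mask 28))"

lemma bit_place_pointers: "bit (place_pointers x) g \<longleftrightarrow> bit x g \<or> 4 \<le> g \<and> g < 32"
  by (auto simp: place_pointers_def bit_or_iff bit_push_bit_iff bit_mask_iff)

lemma not_bit_small: "(x::nat) < 4 \<Longrightarrow> 2 \<le> g \<Longrightarrow> \<not> bit x g"
  using nat_less_exp_iff_bit[of x 2] by simp

lemma represents_init:
  assumes "\<forall>x \<in> set w. x < 4"
  shows "represents ((tape_of w)(0 := place_pointers (tape_of w 0))) (\<lambda>_. 0) (input_sets w)"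
proof -
  have w: "i < length w \<Longrightarrow> 2 \<le> g \<Longrightarrow> \<not> bit (w ! i) g" for i g
    using assms not_bit_small nth_mem by blast
  have t: "tape_of w (int i) = (if i < length w then w ! i else 0)" for i
    by (simp add: tape_of_def)
  show ?thesis unfolding represents_def
  proof (intro conjI allI)
    fix i g
    show "bit (((tape_of w)(0 := place_pointers (tape_of w 0))) (int i)) g
       \<longleftrightarrow> flag (\<lambda>_. 0) (input_sets w) i g"
      using w[of i g] t[of i] by (cases "i = 0") (auto simp: flag_def input_sets_def bit_place_pointers)
  qed simp
qed

text \<open>The empty instance over the empty alphabet is encoded as [2], and 1 to any power allows a
  single step; states 0 and 1 recognise it. All other inputs reach the code of c in state 2. The
  program accepts if pointer r has left position 0.\<close>

definition machine :: "nat \<Rightarrow> pcom \<Rightarrow> tm" where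
  "machine r c = (let body = TSeq (Act place_pointers 0) (TSeq (tape_code c) (seek r)); e = 2 + tsize body in
     [((0, 1), (2, 1, 0)), ((0, 2), (1, 2, 1)), ((1, 1), (2, 1, -1))] @ rules num_symbols body 2 e
     @ map (\<lambda>x. ((e, x), (1, 0, 0))) (filter (\<lambda>x. \<not> bit x 4) [0..<num_symbols]))"

lemma machine_wf:
  assumes "pcom_wf c"
  shows "wf_tm (machine r c)"
proof -
  have "place_pointers x < num_symbols" if "x < num_symbols" for x
    using that unfolding less_num_symbols_iff bit_place_pointers by auto
  then have "tcom_wf num_symbols (TSeq (Act place_pointers 0) (TSeq (tape_code c) (seek r)))"
    using tape_code_wf[OF assms] by (simp add: seek_def)
  then have "wf_tm (rules num_symbols (TSeq (Act place_pointers 0) (TSeq (tape_code c) (seek r))) s e)" for s e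
    by (rule rules_wf)
  then show ?thesis by (simp add: machine_def Let_def wf_tm_def ball_Un del: rules.simps tsize.simps)
qed

lemma machine_accepts_two:
  shows "tm_halted (machine r c) (tm_run (machine r c) 1 (tm_init [2]))"
    and "fst (tm_run (machine r c) 1 (tm_init [2])) = 1"
proof -
  let ?tp = "tape_of [2]"
  have "map_of (machine r c) (0, ?tp 0) = Some (1, 2, 1)"
    by (simp add: machine_def Let_def tape_of_def)
  then have run: "tm_run (machine r c) 1 (tm_init [2]) = (1, ?tp(0 := 2), 1)"
    unfolding tm_init_eq[of "[2]"] by (simp add: tm_run_1)
  then show "fst (tm_run (machine r c) 1 (tm_init [2])) = 1" by simp
  have "(1, 0) \<notin> fst ` set (machine r c)"
    by (auto simp: machine_def Let_def simp del: rules.simps dest: rules_states)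
  then have "map_of (machine r c) (1, 0) = None" by (simp add: map_of_eq_None_iff)
  then show "tm_halted (machine r c) (tm_run (machine r c) 1 (tm_init [2]))"
    unfolding run by (simp add: tm_halted_def tape_of_def)
qed

text \<open>The budget consists of 2 start-up steps, 1 to place the pointers, the program, 4 * n + 2
  for the last seek and 1 for the accepting rule. The conditions on the first symbols make the
  start-up end on cell 0 in state 2 with the tape unchanged.\<close>

lemma machine_run:
  assumes "pcom_wf c" and "is_ptr r" and "\<forall>x \<in> set w. x < 4"
    and "w ! 0 = 1 \<or> w ! 0 = 2 \<and> w ! 1 = 1 \<and> 1 < length w" and "w \<noteq> []"
    and "pexec c (\<lambda>_. 0) (input_sets w) n v A"
  shows "\<exists>t \<le> cost 0 n + 4 * n + 6.
           tm_halted (machine r c) (tm_run (machine r c) t (tm_init w)) \<and>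
           (fst (tm_run (machine r c) t (tm_init w)) = 1 \<longleftrightarrow> v r \<noteq> 0)"
proof -
  define body where "body = TSeq (Act place_pointers 0) (TSeq (tape_code c) (seek r))"
  define e where "e = 2 + tsize body"
  define last where "last = map (\<lambda>x. ((e, x), (1::nat, 0::nat, 0::int))) (filter (\<lambda>x. \<not> bit x 4) [0..<num_symbols])"
  define M where "M = machine r c"
  have M: "M = [((0, 1), (2, 1, 0)), ((0, 2), (1, 2, 1)), ((1, 1), (2, 1, -1))] @ rules num_symbols body 2 e @ last"
    by (simp add: M_def machine_def body_def e_def last_def Let_def del: rules.simps)
  have body_keys: "2 \<le> fst (fst x) \<and> fst (fst x) < e" if "x \<in> set (rules num_symbols body 2 e)" for x
    using rules_states[OF that] by (simp add: e_def)
  have last_keys: "k \<in> fst ` set last \<longleftrightarrow> fst k = e \<and> \<not> bit (snd k) 4 \<and> snd k < num_symbols" for k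
    by (cases k) (force simp: last_def)
  have "2 \<le> e" by (simp add: e_def)
  have body_map: "\<forall>x \<in> set (rules num_symbols body 2 e). map_of M (fst x) = Some (snd x)"
  proof
    fix x assume x: "x \<in> set (rules num_symbols body 2 e)"
    have "map_of (rules num_symbols body 2 e) (fst x) = Some (snd x)"
      using x rules_distinct by simp
    moreover have "fst x \<notin> fst ` set last" using last_keys body_keys[OF x] by auto
    then have "map_of last (fst x) = None" by (simp add: map_of_eq_None_iff)
    moreover have "fst x \<noteq> (0, 1)" "fst x \<noteq> (0, 2)" "fst x \<noteq> (1, 1)"
      using body_keys[OF x] by auto
    ultimately show "map_of M (fst x) = Some (snd x)"
      unfolding M by (simp add: map_add_def)
  qed
  have body_none: "map_of (rules num_symbols body 2 e) (e, x) = None" for x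
    using body_keys by (force simp: map_of_eq_None_iff)
  have accept: "map_of M (e, x) = Some (1, 0, 0)" if "\<not> bit x 4" "x < num_symbols" for x
  proof -
    have "map_of last (e, x) = Some (1, 0, 0)" using that
      by (auto simp: last_def map_of_eq_Some_iff distinct_map inj_on_def comp_def)
    then show ?thesis using body_none[of x] \<open>2 \<le> e\<close> unfolding M by (simp add: map_add_def)
  qed
  have reject: "map_of M (e, x) = None" if "bit x 4" for x
  proof -
    have "(e, x) \<notin> fst ` set last" using that last_keys by simp
    then have "map_of last (e, x) = None" by (simp add: map_of_eq_None_iff)
    then show ?thesis using body_none[of x] \<open>2 \<le> e\<close> unfolding M by (simp add: map_add_def)
  qed
  \<comment> \<open>State 1 has a rule for symbol 1 only; the accepting rule writes 0 so that the
    machine stops there.\<close>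
  have halt: "map_of M (1, 0) = None"
  proof -
    have "(1, 0) \<notin> fst ` set (rules num_symbols body 2 e)" using body_keys by force
    moreover have "(1, 0) \<notin> fst ` set last" using \<open>2 \<le> e\<close> last_keys by simp
    ultimately have "(1, 0) \<notin> fst ` set M" unfolding M by (simp add: image_Un)
    then show ?thesis by (simp add: map_of_eq_None_iff)
  qed
  define tp where "tp = tape_of w"
  have tp: "tp (int i) = (if i < length w then w ! i else 0)" for i
    by (simp add: tp_def tape_of_def)
  have small: "\<forall>i. tp i < num_symbols"
  proof
    fix i
    have "tp i < 4" by (auto simp: tp_def tape_of_def intro!: bspec[OF assms(3)])
    then show "tp i < num_symbols" by (simp add: num_symbols_def)
  qed
  have M0: "map_of M (0, 1) = Some (2, 1, 0)" "map_of M (0, 2) = Some (1, 2, 1)" "map_of M (1, 1) = Some (2, 1, -1)"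
    unfolding M by simp_all
  have "\<exists>t0 \<le> 2. tm_run M t0 (0, tp, 0) = (2, tp, 0)"
  proof (cases "w ! 0 = 1")
    case True
    then have "tp 0 = 1" using tp[of 0] assms(5) by simp
    then have "tm_run M 1 (0, tp, 0) = (2, tp(0 := tp 0), 0)" using M0 by (simp add: tm_run_1)
    then show ?thesis by (intro exI[of _ 1]) simp
  next
    case False
    then have "tp 0 = 2" "tp 1 = 1" using tp[of 0] tp[of 1] assms(4,5) by simp_all
    then have "tm_run M (Suc (Suc 0)) (0, tp, 0) = (2, tp(0 := tp 0, 1 := tp 1), 0)"
      using M0 by (simp add: tm_run_1 tm_run_Suc[of _ _ _ _ _ _ _ "Suc 0"])
    then show ?thesis by (intro exI[of _ "Suc (Suc 0)"]) simp
  qed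
  then obtain t0 where t0: "t0 \<le> 2" "tm_run M t0 (0, tp, 0) = (2, tp, 0)" by blast
  define tp1 where "tp1 = tp(0 := place_pointers (tp 0))"
  have 1: "texec (Act place_pointers 0) tp 0 1 tp1 0"
    unfolding tp1_def by (intro texec_Act') simp_all
  have "within tp1 0 (\<lambda>_. 0) (input_sets w) 0"
    using represents_init[OF assms(3)] by (simp add: within_def tp1_def tp_def)
  from tape_code_exec[OF assms(6,1) this]
  obtain t1 tp2 h2 where 2: "t1 \<le> cost 0 n" "texec (tape_code c) tp1 0 t1 tp2 h2" "within tp2 h2 v A n"
    by auto
  from within_seek[OF 2(3) assms(2)]
  obtain t2 where 3: "t2 \<le> 4 * n + 2" "texec (seek r) tp2 h2 t2 tp2 (int (v r))" by auto
  have "texec body tp 0 (1 + (t1 + t2)) tp2 (int (v r))"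
    unfolding body_def using texec_Seq[OF 1 texec_Seq[OF 2(2) 3(2)]] by simp
  moreover have "place_pointers x < num_symbols" if "x < num_symbols" for x
    using that unfolding less_num_symbols_iff bit_place_pointers by auto
  then have "tcom_wf num_symbols body"
    using tape_code_wf[OF assms(1)] by (simp add: body_def seek_def)
  ultimately have 4: "tm_run M (1 + (t1 + t2)) (2, tp, 0) = (e, tp2, int (v r))" "\<forall>i. tp2 i < num_symbols"
    using rules_run[OF _ _ small body_map] by auto
  have run: "tm_run M (t0 + (1 + (t1 + t2))) (tm_init w) = (e, tp2, int (v r))"
    unfolding tm_run_add[of M t0] tm_init_eq tp_def[symmetric] t0(2) by (rule 4)
  have bit4: "bit (tp2 (int (v r))) 4 \<longleftrightarrow> v r = 0"
    using 2(3) by (auto simp: within_def represents_def flag_def)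
  show ?thesis
  proof (cases "v r = 0")
    case True
    then show ?thesis using run bit4 reject 2(1) 3(1) t0 \<open>2 \<le> e\<close> unfolding M_def[symmetric]
      by (intro exI[of _ "t0 + (1 + (t1 + t2))"]) (auto simp: tm_halted_def)
  next
    case False
    then have "map_of M (e, tp2 (int (v r))) = Some (1, 0, 0)" using accept bit4 4(2) by simp
    then have "tm_run M (t0 + (1 + (t1 + t2)) + 1) (tm_init w) = (1, tp2(int (v r) := 0), int (v r))"
      unfolding tm_run_add[of _ _ 1] run by (simp add: tm_run_1)
    then show ?thesis using False halt 2(1) 3(1) t0 unfolding M_def[symmetric]
      by (intro exI[of _ "t0 + (1 + (t1 + t2)) + 1"]) (auto simp: tm_halted_def)
  qed
qed


section \<open>Computability of linear functions\<close>

definition write_times :: "nat \<Rightarrow> nat \<Rightarrow> tcom" where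
  "write_times n x = foldr (\<lambda>_. TSeq (Act (\<lambda>_. x) 1)) [0..<n] (Act (\<lambda>y. y) 0)"

lemma tcom_wf_write_times: "x < X \<Longrightarrow> tcom_wf X (write_times n x)"
proof -
  assume "x < X"
  then have "tcom_wf X (foldr (\<lambda>_. TSeq (Act (\<lambda>_. x) 1)) is (Act (\<lambda>y. y) 0))" for "is" :: "nat list"
    by (induction "is") auto
  then show ?thesis by (simp add: write_times_def)
qed

lemma texec_write_times:
  "\<exists>m. texec (write_times n x) tp h m (\<lambda>i. if h \<le> i \<and> i < h + int n then x else tp i) (h + int n)"
proof -
  have "\<exists>m. texec (foldr (\<lambda>_. TSeq (Act (\<lambda>_. x) 1)) is (Act (\<lambda>y. y) 0)) tp h m
      (\<lambda>i. if h \<le> i \<and> i < h + int (length is) then x else tp i) (h + int (length is))"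
    for "is" :: "nat list"
  proof (induction "is" arbitrary: tp h)
    case Nil
    have "texec (Act (\<lambda>y. y) 0) tp h 1 (\<lambda>i. if h \<le> i \<and> i < h + int (length []) then x else tp i) h"
      by (intro texec_Act') auto
    then show ?case by auto
  next
    case (Cons a "is")
    obtain m where m: "texec (foldr (\<lambda>_. TSeq (Act (\<lambda>_. x) 1)) is (Act (\<lambda>y. y) 0)) (tp(h := x)) (h + 1) m
      (\<lambda>i. if h + 1 \<le> i \<and> i < h + 1 + int (length is) then x else (tp(h := x)) i) (h + 1 + int (length is))"
      using Cons by blast
    moreover have "(\<lambda>i. if h + 1 \<le> i \<and> i < h + 1 + int (length is) then x else (tp(h := x)) i) =
       (\<lambda>i. if h \<le> i \<and> i < h + int (length (a # is)) then x else tp i)"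
      by auto
    moreover have "h + 1 + int (length is) = h + int (length (a # is))" by simp
    ultimately have "texec (foldr (\<lambda>_. TSeq (Act (\<lambda>_. x) 1)) is (Act (\<lambda>y. y) 0)) (tp(h := x)) (h + 1) m
      (\<lambda>i. if h \<le> i \<and> i < h + int (length (a # is)) then x else tp i) (h + int (length (a # is)))"
      by metis
    then have "texec (foldr (\<lambda>_. TSeq (Act (\<lambda>_. x) 1)) (a # is) (Act (\<lambda>y. y) 0)) tp h (1 + m)
       (\<lambda>i. if h \<le> i \<and> i < h + int (length (a # is)) then x else tp i) (h + int (length (a # is)))"
      using texec_Seq[OF texec_Act] by fastforce
    then show ?case by blast
  qed
  from this[of "[0..<n]"] show ?thesis by (simp add: write_times_def)
qed

text \<open>The function \<open>g\<close> covers passes that only move as well as the last one,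
  which turns twos into ones.\<close>

lemma texec_sweep_right:
  assumes "\<And>i. h \<le> i \<Longrightarrow> i < h + int n \<Longrightarrow> P (tp i)" and "\<not> P (tp (h + int n))"
  shows "\<exists>m. texec (TWhile P (Act g 1)) tp h m (\<lambda>i. if h \<le> i \<and> i < h + int n then g (tp i) else tp i) (h + int n)"
  using assms
proof (induction n arbitrary: tp h)
  case 0
  then have "texec (TWhile P (Act g 1)) tp h 1 tp h" by (intro texec_WhileF) simp
  moreover have "(\<lambda>i. if h \<le> i \<and> i < h + int 0 then g (tp i) else tp i) = tp" by auto
  ultimately show ?case by auto
next
  case (Suc n)
  let ?tp = "tp(h := g (tp h))"
  have "\<exists>m. texec (TWhile P (Act g 1)) ?tp (h + 1) m
      (\<lambda>i. if h + 1 \<le> i \<and> i < h + 1 + int n then g (?tp i) else ?tp i) (h + 1 + int n)"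
    using Suc.prems by (intro Suc.IH) (auto simp: algebra_simps)
  moreover have "(\<lambda>i. if h + 1 \<le> i \<and> i < h + 1 + int n then g (?tp i) else ?tp i) =
     (\<lambda>i. if h \<le> i \<and> i < h + int (Suc n) then g (tp i) else tp i)"
    by auto
  moreover have "h + 1 + int n = h + int (Suc n)" by simp
  ultimately obtain m where "texec (TWhile P (Act g 1)) ?tp (h + 1) m
     (\<lambda>i. if h \<le> i \<and> i < h + int (Suc n) then g (tp i) else tp i) (h + int (Suc n))"
    by metis
  then have "texec (TWhile P (Act g 1)) tp h (Suc (1 + m))
     (\<lambda>i. if h \<le> i \<and> i < h + int (Suc n) then g (tp i) else tp i) (h + int (Suc n))"
    using Suc.prems by (intro texec_WhileT[OF _ texec_Act]) auto
  then show ?case by blast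
qed

lemma texec_sweep_left:
  assumes "\<And>i. h - int n < i \<Longrightarrow> i \<le> h \<Longrightarrow> P (tp i)" and "\<not> P (tp (h - int n))"
  shows "\<exists>m. texec (TWhile P (Act (\<lambda>x. x) (-1))) tp h m tp (h - int n)"
  using assms
proof (induction n arbitrary: h)
  case 0
  then have "texec (TWhile P (Act (\<lambda>x. x) (-1))) tp h 1 tp h" by (intro texec_WhileF) simp
  then show ?case by auto
next
  case (Suc n)
  have "\<exists>m. texec (TWhile P (Act (\<lambda>x. x) (-1))) tp (h - 1) m tp (h - 1 - int n)"
    using Suc.prems by (intro Suc.IH) (auto simp: algebra_simps)
  moreover have "h - 1 - int n = h - int (Suc n)" by simp
  ultimately obtain m where m: "texec (TWhile P (Act (\<lambda>x. x) (-1))) tp (h - 1) m tp (h - int (Suc n))"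
    by metis
  have "texec (Act (\<lambda>x. x) (-1)) tp h 1 tp (h - 1)" by (intro texec_Act') auto
  then have "texec (TWhile P (Act (\<lambda>x. x) (-1))) tp h (Suc (1 + m)) tp (h - int (Suc n))"
    using Suc.prems m by (intro texec_WhileT) auto
  then show ?case by blast
qed

text \<open>The ones are consumed from the right: each becomes a 2, and c further twos are appended.
  Finally all twos are turned into ones and d ones are added.\<close>

definition linear_code :: "nat \<Rightarrow> nat \<Rightarrow> tcom" where
  "linear_code c d =
     TSeq (TWhile (\<lambda>x. x = 1) (Act (\<lambda>x. x) 1)) (TSeq (Act (\<lambda>x. x) (-1))
     (TSeq (TWhile (\<lambda>x. x = 1)
       (TSeq (Act (\<lambda>_. 2) 1) (TSeq (TWhile (\<lambda>x. x = 2) (Act (\<lambda>x. x) 1)) (TSeq (write_times c 2)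
         (TSeq (Act (\<lambda>x. x) (-1)) (TWhile (\<lambda>x. x = 2) (Act (\<lambda>x. x) (-1))))))))
     (TSeq (Act (\<lambda>x. x) 1) (TSeq (TWhile (\<lambda>x. x = 2) (Act (\<lambda>_. 1) 1)) (write_times d 1)))))"

text \<open>The shape of the tape between rounds: a ones not yet consumed, then b twos. Cell -1 is
  blank, which stops the loop once no ones remain.\<close>

definition ones_twos :: "nat \<Rightarrow> nat \<Rightarrow> int \<Rightarrow> nat" where
  "ones_twos a b i = (if 0 \<le> i \<and> i < int a then 1 else if int a \<le> i \<and> i < int (a + b) then 2 else 0)"

text \<open>One round trades a one for 1 + c twos, hence the slope \<open>Suc c\<close>.\<close>

lemma linear_body:
  "\<exists>m. texec (TSeq (Act (\<lambda>_. 2) 1) (TSeq (TWhile (\<lambda>x. x = 2) (Act (\<lambda>x. x) 1)) (TSeq (write_times c 2)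
         (TSeq (Act (\<lambda>x. x) (-1)) (TWhile (\<lambda>x. x = 2) (Act (\<lambda>x. x) (-1)))))))
     (ones_twos (Suc a) b) (int a) m (ones_twos a (Suc c + b)) (int a - 1)"
proof -
  have 1: "texec (Act (\<lambda>_. 2) 1) (ones_twos (Suc a) b) (int a) 1 (ones_twos a (Suc b)) (int a + 1)"
    by (intro texec_Act') (auto simp: ones_twos_def)
  have "\<exists>m. texec (TWhile (\<lambda>x. x = 2) (Act (\<lambda>x. x) 1)) (ones_twos a (Suc b)) (int a + 1) m
     (\<lambda>i. if int a + 1 \<le> i \<and> i < int a + 1 + int b then ones_twos a (Suc b) i else ones_twos a (Suc b) i)
     (int a + 1 + int b)"
    by (intro texec_sweep_right) (auto simp: ones_twos_def)
  then obtain m2 where 2: "texec (TWhile (\<lambda>x. x = 2) (Act (\<lambda>x. x) 1)) (ones_twos a (Suc b)) (int a + 1) m2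
     (ones_twos a (Suc b)) (int a + 1 + int b)" by auto
  have "(\<lambda>i. if int a + 1 + int b \<le> i \<and> i < int a + 1 + int b + int c then 2 else ones_twos a (Suc b) i)
     = ones_twos a (Suc c + b)" by (auto simp: ones_twos_def)
  then obtain m3 where 3: "texec (write_times c 2) (ones_twos a (Suc b)) (int a + 1 + int b) m3
     (ones_twos a (Suc c + b)) (int a + 1 + int b + int c)"
    using texec_write_times[of c 2 "ones_twos a (Suc b)" "int a + 1 + int b"] by auto
  have 4: "texec (Act (\<lambda>x. x) (-1)) (ones_twos a (Suc c + b)) (int a + 1 + int b + int c) 1
     (ones_twos a (Suc c + b)) (int a + int b + int c)"
    by (intro texec_Act') auto
  have "\<exists>m. texec (TWhile (\<lambda>x. x = 2) (Act (\<lambda>x. x) (-1))) (ones_twos a (Suc c + b)) (int a + int b + int c) m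
     (ones_twos a (Suc c + b)) (int a + int b + int c - int (Suc c + b))"
    by (intro texec_sweep_left) (auto simp: ones_twos_def)
  moreover have "int a + int b + int c - int (Suc c + b) = int a - 1" by simp
  ultimately obtain m5 where 5: "texec (TWhile (\<lambda>x. x = 2) (Act (\<lambda>x. x) (-1))) (ones_twos a (Suc c + b))
     (int a + int b + int c) m5 (ones_twos a (Suc c + b)) (int a - 1)" by metis
  show ?thesis using texec_Seq[OF 1 texec_Seq[OF 2 texec_Seq[OF 3 texec_Seq[OF 4 5]]]] by blast
qed

lemma linear_loop:
  "\<exists>m. texec (TWhile (\<lambda>x. x = 1)
       (TSeq (Act (\<lambda>_. 2) 1) (TSeq (TWhile (\<lambda>x. x = 2) (Act (\<lambda>x. x) 1)) (TSeq (write_times c 2)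
         (TSeq (Act (\<lambda>x. x) (-1)) (TWhile (\<lambda>x. x = 2) (Act (\<lambda>x. x) (-1))))))))
     (ones_twos a b) (int a - 1) m (ones_twos 0 (Suc c * a + b)) (-1)"
proof (induction a arbitrary: b)
  case 0
  have "ones_twos 0 b (-1) \<noteq> 1" by (simp add: ones_twos_def)
  then show ?case using texec_WhileF[of "\<lambda>x. x = 1" "ones_twos 0 b" "-1"] by auto
next
  case (Suc a)
  obtain m1 m2 where m: "texec (TSeq (Act (\<lambda>_. 2) 1) (TSeq (TWhile (\<lambda>x. x = 2) (Act (\<lambda>x. x) 1)) (TSeq (write_times c 2)
         (TSeq (Act (\<lambda>x. x) (-1)) (TWhile (\<lambda>x. x = 2) (Act (\<lambda>x. x) (-1)))))))
       (ones_twos (Suc a) b) (int a) m1 (ones_twos a (Suc c + b)) (int a - 1)"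
     "texec (TWhile (\<lambda>x. x = 1)
       (TSeq (Act (\<lambda>_. 2) 1) (TSeq (TWhile (\<lambda>x. x = 2) (Act (\<lambda>x. x) 1)) (TSeq (write_times c 2)
         (TSeq (Act (\<lambda>x. x) (-1)) (TWhile (\<lambda>x. x = 2) (Act (\<lambda>x. x) (-1))))))))
       (ones_twos a (Suc c + b)) (int a - 1) m2 (ones_twos 0 (Suc c * a + (Suc c + b))) (-1)"
    using linear_body[of c a b] Suc[of "Suc c + b"] by blast
  have "ones_twos (Suc a) b (int a) = 1" by (simp add: ones_twos_def)
  note texec_WhileT[where P = "\<lambda>x. x = 1", OF this m]
  moreover have "Suc c * a + (Suc c + b) = Suc c * Suc a + b" "int a = int (Suc a) - 1" by simp_all
  ultimately show ?case by metis
qed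

lemma tm_computable_linear: "tm_computable (\<lambda>k. Suc c * k + d)"
proof -
  let ?M = "rules 3 (linear_code c d) 0 (tsize (linear_code c d))"
  have wf: "tcom_wf 3 (linear_code c d)"
    by (simp add: linear_code_def tcom_wf_write_times)
  have "\<exists>t. let (q, tp, h) = tm_run ?M t (tm_init (replicate k 1)) in
         tm_halted ?M (q, tp, h) \<and> (\<forall>i::int. 0 \<le> i \<and> i < int (Suc c * k + d) \<longrightarrow> tp i = 1)
         \<and> tp (int (Suc c * k + d)) = 0" for k
  proof -
    define n where "n = Suc c * k"
    have tape: "tape_of (replicate k 1) = ones_twos k 0"
      by (rule ext) (auto simp: tape_of_def ones_twos_def)
    have "\<exists>m. texec (TWhile (\<lambda>x. x = 1) (Act (\<lambda>x. x) 1)) (ones_twos k 0) 0 m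
       (\<lambda>i. if 0 \<le> i \<and> i < 0 + int k then ones_twos k 0 i else ones_twos k 0 i) (0 + int k)"
      by (intro texec_sweep_right) (auto simp: ones_twos_def)
    then obtain m1 where 1: "texec (TWhile (\<lambda>x. x = 1) (Act (\<lambda>x. x) 1)) (ones_twos k 0) 0 m1 (ones_twos k 0) (int k)"
      by auto
    have 2: "texec (Act (\<lambda>x. x) (-1)) (ones_twos k 0) (int k) 1 (ones_twos k 0) (int k - 1)"
      by (intro texec_Act') auto
    obtain m3 where 3: "texec (TWhile (\<lambda>x. x = 1)
       (TSeq (Act (\<lambda>_. 2) 1) (TSeq (TWhile (\<lambda>x. x = 2) (Act (\<lambda>x. x) 1)) (TSeq (write_times c 2)
         (TSeq (Act (\<lambda>x. x) (-1)) (TWhile (\<lambda>x. x = 2) (Act (\<lambda>x. x) (-1))))))))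
      (ones_twos k 0) (int k - 1) m3 (ones_twos 0 n) (-1)"
      using linear_loop[of c k 0] by (auto simp: n_def)
    have 4: "texec (Act (\<lambda>x. x) 1) (ones_twos 0 n) (-1) 1 (ones_twos 0 n) 0"
      by (intro texec_Act') auto
    have "\<exists>m. texec (TWhile (\<lambda>x. x = 2) (Act (\<lambda>_. 1) 1)) (ones_twos 0 n) 0 m
       (\<lambda>i. if 0 \<le> i \<and> i < 0 + int n then 1 else ones_twos 0 n i) (0 + int n)"
      by (intro texec_sweep_right) (auto simp: ones_twos_def)
    moreover have "(\<lambda>i. if 0 \<le> i \<and> i < 0 + int n then 1 else ones_twos 0 n i) = ones_twos n 0"
      by (auto simp: ones_twos_def)
    ultimately obtain m5 where 5: "texec (TWhile (\<lambda>x. x = 2) (Act (\<lambda>_. 1) 1)) (ones_twos 0 n) 0 m5 (ones_twos n 0) (int n)"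
      by auto
    have "(\<lambda>i. if int n \<le> i \<and> i < int n + int d then 1 else ones_twos n 0 i) = ones_twos (n + d) 0"
      by (auto simp: ones_twos_def)
    then obtain m6 where 6: "texec (write_times d 1) (ones_twos n 0) (int n) m6 (ones_twos (n + d) 0) (int n + int d)"
      using texec_write_times[of d 1 "ones_twos n 0" "int n"] by auto
    have "\<exists>t. texec (linear_code c d) (ones_twos k 0) 0 t (ones_twos (n + d) 0) (int n + int d)"
      unfolding linear_code_def
      using texec_Seq[OF 1 texec_Seq[OF 2 texec_Seq[OF 3 texec_Seq[OF 4 texec_Seq[OF 5 6]]]]] by blast
    then obtain t where "texec (linear_code c d) (ones_twos k 0) 0 t (ones_twos (n + d) 0) (int n + int d)"
      by blast
    then have "tm_run ?M t (tm_init (replicate k 1)) = (tsize (linear_code c d), ones_twos (n + d) 0, int n + int d)"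
      unfolding tm_init_eq tape using wf by (intro rules_run_self) (auto simp: ones_twos_def)
    moreover have "map_of ?M (tsize (linear_code c d), x) = None" for x
      by (auto simp: map_of_eq_None_iff dest: rules_states)
    ultimately show ?thesis
      by (intro exI[of _ t]) (simp add: tm_halted_def ones_twos_def n_def)
  qed
  then show ?thesis unfolding tm_computable_def using rules_wf[OF wf] by blast
qed

section \<open>Capping letter counts\<close>

text \<open>The cut between the two factors falls before, after or inside the block of a's.\<close>

lemma replicate_mem_conc_iff:
  "u @ replicate m a @ v \<in> conc A B \<longleftrightarrow>
     (\<exists>u1 u2. u = u1 @ u2 \<and> u1 \<in> A \<and> u2 @ replicate m a @ v \<in> B) \<or>
     (\<exists>v1 v2. v = v1 @ v2 \<and> u @ replicate m a @ v1 \<in> A \<and> v2 \<in> B) \<or>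
     (\<exists>i j. i + j = m \<and> u @ replicate i a \<in> A \<and> replicate j a @ v \<in> B)" (is "?l \<longleftrightarrow> ?r")
proof
  assume ?l
  then obtain x y where xy: "u @ replicate m a @ v = x @ y" "x \<in> A" "y \<in> B"
    by (auto simp: conc_def)
  then consider (1) z where "u = x @ z" "z @ replicate m a @ v = y"
    | (2) z where "u @ z = x" "replicate m a @ v = z @ y"
    by (auto simp: append_eq_append_conv2)
  then show ?r
  proof cases
    case 1
    then show ?thesis using xy by blast
  next
    case 2
    then consider (3) z' where "replicate m a = z @ z'" "z' @ v = y"
      | (4) z' where "replicate m a @ z' = z" "v = z' @ y"
      by (auto simp: append_eq_append_conv2)
    then show ?thesis
    proof cases
      case 3
      have "\<forall>x\<in>set (z @ z'). x = a" unfolding 3(1)[symmetric] by simp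
      then have "z = replicate (length z) a" "z' = replicate (length z') a"
        by (simp_all add: replicate_length_same)
      moreover have "length z + length z' = m" using arg_cong[OF 3(1), of length] by simp
      ultimately show ?thesis using xy 2 3 by metis
    next
      case 4
      then show ?thesis using xy 2 by auto
    qed
  qed
next
  assume ?r
  then show ?l
  proof (elim disjE exE conjE)
    fix i j assume "i + j = m" "u @ replicate i a \<in> A" "replicate j a @ v \<in> B"
    moreover have "u @ replicate (i + j) a @ v = (u @ replicate i a) @ (replicate j a @ v)"
      by (simp add: replicate_add)
    ultimately show ?l unfolding conc_def by blast
  qed (unfold conc_def, (metis (mono_tags, lifting) append.assoc mem_Collect_eq)+)
qed

text \<open>Aperiodicity for powers of one letter instead of arbitrary words, since only such blocks
  are ever capped.\<close>

definition aperiodic_lang :: "'a \<Rightarrow> 'a list set \<Rightarrow> bool" where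
  "aperiodic_lang a L \<longleftrightarrow>
     (\<exists>N. \<forall>m\<ge>N. \<forall>u v. u @ replicate m a @ v \<in> L \<longleftrightarrow> u @ replicate (Suc m) a @ v \<in> L)"

text \<open>A cut inside a block of length at least N1 + N2 leaves a part at least N1 long on the
  left or at least N2 long on the right, and that part absorbs one more letter. In a block of length
  above N1 + N2 one of the parts is long enough to give a letter up.\<close>

lemma aperiodic_conc:
  assumes "aperiodic_lang a A" and "aperiodic_lang a B"
  shows "aperiodic_lang a (conc A B)"
proof -
  obtain N1 where 1: "\<And>m u v. m \<ge> N1 \<Longrightarrow> u @ replicate m a @ v \<in> A \<longleftrightarrow> u @ replicate (Suc m) a @ v \<in> A"
    using assms(1) unfolding aperiodic_lang_def by blast
  obtain N2 where 2: "\<And>m u v. m \<ge> N2 \<Longrightarrow> u @ replicate m a @ v \<in> B \<longleftrightarrow> u @ replicate (Suc m) a @ v \<in> B"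
    using assms(2) unfolding aperiodic_lang_def by blast
  have split: "(\<exists>i j. i + j = m \<and> u @ replicate i a \<in> A \<and> replicate j a @ v \<in> B) \<longleftrightarrow>
      (\<exists>i j. i + j = Suc m \<and> u @ replicate i a \<in> A \<and> replicate j a @ v \<in> B)" (is "?l \<longleftrightarrow> ?r")
    if "m \<ge> N1 + N2" for m u v
  proof
    assume ?l
    then obtain i j where ij: "i + j = m" "u @ replicate i a \<in> A" "replicate j a @ v \<in> B" by blast
    show ?r
    proof (cases "i \<ge> N1")
      case True
      then have "u @ replicate (Suc i) a \<in> A" using 1[of i u "[]"] ij by simp
      then show ?thesis using ij by (metis add_Suc)
    next
      case False
      then have "replicate (Suc j) a @ v \<in> B" using 2[of j "[]" v] ij that by simp
      then show ?thesis using ij by (metis add_Suc_right)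
    qed
  next
    assume ?r
    then obtain i j where ij: "i + j = Suc m" "u @ replicate i a \<in> A" "replicate j a @ v \<in> B" by blast
    show ?l
    proof (cases "i > N1")
      case True
      then obtain i' where i': "i = Suc i'" "N1 \<le> i'" by (cases i) auto
      then have "u @ replicate i' a \<in> A" using 1[of i' u "[]"] ij by simp
      moreover have "i' + j = m" using ij i' by simp
      ultimately show ?thesis using ij by blast
    next
      case False
      then have "j > N2" using ij that by simp
      then obtain j' where j': "j = Suc j'" "N2 \<le> j'" by (cases j) auto
      then have "replicate j' a @ v \<in> B" using 2[of j' "[]" v] ij by simp
      moreover have "i + j' = m" using ij j' by simp
      ultimately show ?thesis using ij by blast
    qed
  qed
  show ?thesis unfolding aperiodic_lang_def
  proof (intro exI allI impI)
    fix m u v assume m: "N1 + N2 \<le> m"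
    then have "N1 \<le> m" "N2 \<le> m" by auto
    then show "u @ replicate m a @ v \<in> conc A B \<longleftrightarrow> u @ replicate (Suc m) a @ v \<in> conc A B"
      by (simp only: replicate_mem_conc_iff split[OF m] 1[OF \<open>N1 \<le> m\<close>] 2[OF \<open>N2 \<le> m\<close>])
  qed
qed

text \<open>The easy half of Schuetzenberger's theorem, by induction over the construction of the
  language.\<close>

lemma star_free_aperiodic: "star_free \<Sigma> L \<Longrightarrow> aperiodic_lang a L"
proof (induction rule: star_free.induct)
  case (sf_finite L)
  have "\<exists>N. \<forall>w\<in>L. length w < N"
    using finite_nat_set_iff_bounded[of "length ` L"] sf_finite by auto
  then obtain N where N: "\<forall>w\<in>L. length w < N" by blast
  show ?case unfolding aperiodic_lang_def
  proof (intro exI allI impI)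
    fix m u v assume "N \<le> m"
    then have "u @ replicate m a @ v \<notin> L" "u @ replicate (Suc m) a @ v \<notin> L"
      using N[rule_format, of "u @ replicate m a @ v"] N[rule_format, of "u @ replicate (Suc m) a @ v"]
      by (auto simp del: replicate_Suc)
    then show "u @ replicate m a @ v \<in> L \<longleftrightarrow> u @ replicate (Suc m) a @ v \<in> L" by blast
  qed
next
  case (sf_union A B)
  then obtain N1 N2 where
    "\<forall>m\<ge>N1. \<forall>u v. u @ replicate m a @ v \<in> A \<longleftrightarrow> u @ replicate (Suc m) a @ v \<in> A"
    "\<forall>m\<ge>N2. \<forall>u v. u @ replicate m a @ v \<in> B \<longleftrightarrow> u @ replicate (Suc m) a @ v \<in> B"
    unfolding aperiodic_lang_def by blast
  then show ?case unfolding aperiodic_lang_def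
    by (intro exI[of _ "max N1 N2"]) simp
next
  case (sf_conc A B)
  then show ?case by (intro aperiodic_conc)
next
  case (sf_compl A)
  then obtain N where
    "\<forall>m\<ge>N. \<forall>u v. u @ replicate m a @ v \<in> A \<longleftrightarrow> u @ replicate (Suc m) a @ v \<in> A"
    unfolding aperiodic_lang_def by blast
  \<comment> \<open>\<open>Suc N\<close> makes m positive, so both words contain a and agree on
    being words over \<Sigma>.\<close>
  then show ?case unfolding aperiodic_lang_def
    by (intro exI[of _ "Suc N"]) (simp add: in_lists_conv_set)
qed

section \<open>Lengths of walks in a finite relation\<close>

lemma not_inj_on_atMost: "\<not> inj_on f {..m::nat} \<Longrightarrow> \<exists>i j. i < j \<and> j \<le> m \<and> f i = f j"
proof -
  assume "\<not> inj_on f {..m}"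
  then obtain x y where xy: "x \<le> m" "y \<le> m" "f x = f y" "x \<noteq> y" by (auto simp: inj_on_def)
  then show ?thesis by (metis nat_neq_iff)
qed

text \<open>Pigeonhole on pairs of vertex and position modulo d: a walk of length at least card Q *
  d repeats a pair, and removing the part in between keeps the ends and the length modulo d.\<close>

lemma relpow_shorten:
  assumes "R \<subseteq> Q \<times> Q" and "finite Q" and "0 < d" and "q \<in> Q" and "(q, p) \<in> R ^^ m"
  shows "\<exists>m' < card Q * d. m' mod d = m mod d \<and> (q, p) \<in> R ^^ m'"
  using assms(5)
proof (induction m rule: less_induct)
  case (less m)
  show ?case
  proof (cases "m < card Q * d")
    case True
    then show ?thesis using less.prems by blast
  next
    case False
    obtain f where f: "f 0 = q" "f m = p" "\<forall>i<m. (f i, f (Suc i)) \<in> R"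
      using less.prems by (auto simp: relpow_fun_conv)
    have fQ: "f i \<in> Q" if "i \<le> m" for i
      proof (cases i)
    case 0
    then show ?thesis using f(1) assms(1,4) by simp
  next
    case (Suc b)
    then have "(f b, f i) \<in> R" using f(3) that by simp
    then show ?thesis using assms(1,4) by blast
  qed
    have "\<not> inj_on (\<lambda>i. (f i, i mod d)) {..m}"
    proof
      assume "inj_on (\<lambda>i. (f i, i mod d)) {..m}"
      moreover have "(\<lambda>i. (f i, i mod d)) ` {..m} \<subseteq> Q \<times> {..<d}" using fQ assms(3) by auto
      ultimately have "card {..m} \<le> card (Q \<times> {..<d})"
        using assms(2) by (intro card_inj_on_le) auto
      then show False using False by (simp add: card_cartesian_product)
    qed
    then obtain i j where ij: "i < j" "j \<le> m" "f i = f j" "i mod d = j mod d"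
      by (auto dest: not_inj_on_atMost)
    have "(q, f i) \<in> R ^^ i" unfolding relpow_fun_conv using f ij by (intro exI[of _ f]) auto
    moreover have "(f j, p) \<in> R ^^ (m - j)"
      unfolding relpow_fun_conv using f ij by (intro exI[of _ "\<lambda>l. f (j + l)"]) auto
    ultimately have w: "(q, p) \<in> R ^^ (i + (m - j))"
      unfolding relpow_add using ij(3) by (metis relcompI)
    have "(i + (m - j)) mod d = (j + (m - j)) mod d" using ij(4) by (metis mod_add_left_eq)
    then have "(i + (m - j)) mod d = m mod d" using ij by simp
    then show ?thesis using less.IH[of "i + (m - j)"] w ij by auto
  qed
qed

lemma relpow_loop: "(r, r) \<in> R ^^ d \<Longrightarrow> (r, r) \<in> R ^^ (d * k)"
proof (induction k)
  case (Suc k)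
  then show ?case by (auto simp: relpow_add)
qed simp

text \<open>A walk of length at least card Q visits a state r on a cycle of length d at most card Q. By
  aperiodicity closed walks at r exist in all large lengths, and shortening them modulo d and
  pumping the cycle gives every length from (card Q)^2 on.\<close>

lemma relpow_all_lengths:
  assumes R: "R \<subseteq> Q \<times> Q" "finite Q" and q: "q \<in> Q" and walk: "(q, p) \<in> R ^^ m0" "card Q \<le> m0"
    and aperiodic: "\<And>r. r \<in> Q \<Longrightarrow> \<exists>N. \<forall>m\<ge>N. (r, r) \<in> R ^^ m \<longleftrightarrow> (r, r) \<in> R ^^ Suc m"
    and m: "2 * card Q * card Q \<le> m"
  shows "(q, p) \<in> R ^^ m"
proof -
  let ?n = "card Q"
  obtain f where f: "f 0 = q" "f m0 = p" "\<forall>i<m0. (f i, f (Suc i)) \<in> R"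
    using walk by (auto simp: relpow_fun_conv)
  have fQ: "f i \<in> Q" if "i \<le> m0" for i
    proof (cases i)
    case 0
    then show ?thesis using f(1) q R(1) by simp
  next
    case (Suc b)
    then have "(f b, f i) \<in> R" using f(3) that by simp
    then show ?thesis using q R(1) by blast
  qed
  have "\<not> inj_on f {..?n}"
  proof
    assume "inj_on f {..?n}"
    moreover have "f ` {..?n} \<subseteq> Q" using fQ walk(2) by auto
    ultimately have "card {..?n} \<le> card Q" using R by (intro card_inj_on_le) auto
    then show False by simp
  qed
  then obtain i j where ij: "i < j" "j \<le> ?n" "f i = f j"
    by (auto dest: not_inj_on_atMost)
  define r where "r = f i"
  define d where "d = j - i"
  have r: "r \<in> Q" using fQ ij walk by (simp add: r_def)
  have d: "0 < d" "d \<le> ?n" using ij by (auto simp: d_def)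
  have qr: "(q, r) \<in> R ^^ i"
    unfolding relpow_fun_conv using f ij walk by (intro exI[of _ f]) (auto simp: r_def)
  have rr: "(r, r) \<in> R ^^ d"
    unfolding relpow_fun_conv using f ij walk
    by (intro exI[of _ "\<lambda>l. f (i + l)"]) (auto simp: r_def d_def)
  have "(r, p) \<in> R ^^ (m0 - j)"
    unfolding relpow_fun_conv using f ij walk
    by (intro exI[of _ "\<lambda>l. f (j + l)"]) (auto simp: r_def)
  \<comment> \<open>Modulus 1 imposes no congruence: this is plain removal of cycles.\<close>
  from relpow_shorten[OF R _ r this, of 1]
  obtain y where y: "y < ?n" "(r, p) \<in> R ^^ y" by auto
  obtain N where N: "\<And>m. m \<ge> N \<Longrightarrow> (r, r) \<in> R ^^ m \<longleftrightarrow> (r, r) \<in> R ^^ Suc m"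
    using aperiodic[OF r] by blast
  have const: "(r, r) \<in> R ^^ (N + l) \<longleftrightarrow> (r, r) \<in> R ^^ N" for l
  proof (induction l)
    case (Suc l)
    have "(r, r) \<in> R ^^ (N + l) \<longleftrightarrow> (r, r) \<in> R ^^ Suc (N + l)" by (rule N) simp
    then show ?case using Suc unfolding add_Suc_right by blast
  qed simp
  \<comment> \<open>Some large length is realised, namely d * N by running round the cycle N times;
    as all lengths from N on behave alike, they all are.\<close>
  have "N \<le> d * N" using d by simp
  then obtain l where "d * N = N + l" using le_Suc_ex by blast
  then have all: "(r, r) \<in> R ^^ (N + l)" for l
    using const relpow_loop[OF rr, of N] by metis
  \<comment> \<open>The length left for a closed walk at r. As i and y are below card Q and (card
    Q)^2 + 2 \<ge> 2 * card Q, at least (card Q)^2 remains.\<close>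
  define z where "z = m - i - y"
  have "?n * ?n + ?n + ?n \<le> 2 * ?n * ?n + 1 + 1"
  proof (cases "?n \<le> 1")
    case True
    then have "?n = 0 \<or> ?n = 1" by linarith
    then show ?thesis by auto
  next
    case False
    then have "2 * ?n \<le> ?n * ?n" by (intro mult_le_mono1) simp
    then show ?thesis unfolding mult.assoc by linarith
  qed
  moreover have "i + 1 \<le> ?n" "y + 1 \<le> ?n" using ij y by auto
  ultimately have z: "m = i + z + y" "?n * ?n \<le> z" using m by (auto simp: z_def)
  \<comment> \<open>The length z itself may lie below N. The larger length z + d * N has the same
    residue modulo d; shortening it gives some z' \<le> z, and rounds of the cycle fill the
    gap.\<close>
  have "N \<le> z + d * N" using \<open>N \<le> d * N\<close> by (rule trans_le_add2)
  then obtain l where "z + d * N = N + l" using le_Suc_ex by blast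
  then have "(r, r) \<in> R ^^ (z + d * N)" using all by metis
  from relpow_shorten[OF R d(1) r this]
  obtain z' where z': "z' < ?n * d" "z' mod d = z mod d" "(r, r) \<in> R ^^ z'" by auto
  have "?n * d \<le> ?n * ?n" using d by simp
  then have "z' \<le> z" using z' z by linarith
  then have "d dvd z - z'" using z'(2) mod_eq_dvd_iff_nat[of z' z d] by metis
  then obtain t where "z = z' + d * t" using \<open>z' \<le> z\<close> by (metis dvd_def le_add_diff_inverse)
  then have "(r, r) \<in> R ^^ z" using z'(3) relpow_loop[OF rr, of t] by (auto simp: relpow_add)
  then have "(q, p) \<in> R ^^ (i + z + y)" using qr y(2) by (auto simp: relpow_add)
  then show ?thesis using z by simp
qed

section \<open>Letter powers and sorted words in an automaton\<close>

definition letter_rel :: "(nat \<times> nat \<times> nat) list \<Rightarrow> nat \<Rightarrow> (nat \<times> nat) set" where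
  "letter_rel \<delta> a = {(q, p). (q, a, p) \<in> set \<delta>}"

lemma nfa_path_replicate: "nfa_path \<delta> q (replicate m a) p \<longleftrightarrow> (q, p) \<in> letter_rel \<delta> a ^^ m"
proof (induction m arbitrary: q)
  case (Suc m)
  have "(q, p) \<in> letter_rel \<delta> a ^^ Suc m \<longleftrightarrow> (\<exists>q'. (q, q') \<in> letter_rel \<delta> a \<and> (q', p) \<in> letter_rel \<delta> a ^^ m)"
    by (metis relpow_Suc_D2 relpow_Suc_I2)
  then show ?case using Suc by (auto simp: letter_rel_def)
qed auto

lemma nfa_path_append: "nfa_path \<delta> q (u @ v) p \<longleftrightarrow> (\<exists>r. nfa_path \<delta> q u r \<and> nfa_path \<delta> r v p)"
  by (induction u arbitrary: q) auto

lemma nfa_path_state: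
  assumes "wf_nfa k (n, \<delta>, q0, F)" and "nfa_path \<delta> q w p" and "q < n"
  shows "p < n"
  using assms(2,3)
proof (induction w arbitrary: q)
  case (Cons a w)
  then show ?case using assms(1) by (fastforce simp: wf_nfa_def)
qed auto

text \<open>Total star-freeness is applied to the languages from a state r back to r; their powers
  of a are the closed walks of \<open>letter_rel\<close> at r.\<close>

lemma nfa_path_replicate_threshold:
  assumes wf: "wf_nfa k (n, \<delta>, q0, F)" and tsf: "totally_star_free k (n, \<delta>, q0, F)"
    and "q < n" and "2 * n * n \<le> m" and "2 * n * n \<le> m'"
    and path: "nfa_path \<delta> q (replicate m a) p"
  shows "nfa_path \<delta> q (replicate m' a) p"
proof -
  let ?R = "letter_rel \<delta> a"
  have "(q, p) \<in> ?R ^^ m'"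
  proof (rule relpow_all_lengths[of ?R "{..<n}" q p m])
    show "?R \<subseteq> {..<n} \<times> {..<n}" using wf by (auto simp: wf_nfa_def letter_rel_def)
    have "n \<le> n * n" by (rule le_square)
    then show "card {..<n} \<le> m" using assms(4) unfolding mult.assoc card_lessThan by linarith
    show "\<exists>N. \<forall>m\<ge>N. (r, r) \<in> ?R ^^ m \<longleftrightarrow> (r, r) \<in> ?R ^^ Suc m" if "r \<in> {..<n}" for r
    proof -
      have "star_free (alphabet k) {w. nfa_path \<delta> r w r}"
        using tsf that by (simp add: totally_star_free_def nfa_lang_from_def)
      then obtain N where "\<forall>m\<ge>N. \<forall>u v. u @ replicate m a @ v \<in> {w. nfa_path \<delta> r w r} \<longleftrightarrow>
          u @ replicate (Suc m) a @ v \<in> {w. nfa_path \<delta> r w r}"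
        using star_free_aperiodic[of _ _ a] unfolding aperiodic_lang_def by blast
      from this[rule_format, of _ "[]" "[]"] show ?thesis
        by (auto simp: nfa_path_replicate simp del: replicate_Suc relpow.simps)
    qed
  qed (use assms in \<open>auto simp: nfa_path_replicate\<close>)
  then show ?thesis by (simp add: nfa_path_replicate)
qed

definition sorted_word :: "(nat \<Rightarrow> nat) \<Rightarrow> nat \<Rightarrow> nat list" where
  "sorted_word c k = concat (map (\<lambda>a. replicate (c a) a) [0..<k])"

lemma sorted_word_simps [simp]: "sorted_word c 0 = []"
  "sorted_word c (Suc k) = sorted_word c k @ replicate (c k) k"
  by (simp_all add: sorted_word_def)

lemma sorted_word_in_lists: "sorted_word c k \<in> lists (alphabet k)"
  by (auto simp: sorted_word_def alphabet_def in_lists_conv_set)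

lemma count_sorted_word: "count (mset (sorted_word c k)) a = (if a < k then c a else 0)"
  by (induction k) (auto simp: less_Suc_eq)

text \<open>Each block is capped between the same two states as before. The argument works with path
  languages between arbitrary states, which may fail to be commutative.\<close>

lemma nfa_path_sorted_word_cap:
  assumes "wf_nfa k (n, \<delta>, q0, F)" and "totally_star_free k (n, \<delta>, q0, F)"
    and "q < n" and "2 * n * n \<le> D"
    and "nfa_path \<delta> q (sorted_word c j) p"
  shows "nfa_path \<delta> q (sorted_word (\<lambda>a. min (c a) D) j) p"
  using assms(5)
proof (induction j arbitrary: p)
  case (Suc j)
  then obtain r where r: "nfa_path \<delta> q (sorted_word c j) r" "nfa_path \<delta> r (replicate (c j) j) p"
    by (auto simp: nfa_path_append)
  have "r < n" using nfa_path_state[OF assms(1) r(1) assms(3)] .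
  then have "nfa_path \<delta> r (replicate (min (c j) D) j) p"
    using nfa_path_replicate_threshold[OF assms(1,2) _ _ assms(4) r(2)] r(2) assms(4)
    by (cases "c j \<le> D") (auto simp: min_def)
  then show ?case using Suc.IH[OF r(1)] by (auto simp: nfa_path_append)
qed simp

lemma commutative_move_front:
  assumes "commutative_lang L" and "u @ x @ a # y \<in> L"
  shows "u @ a # x @ y \<in> L"
  using assms(2)
proof (induction x arbitrary: y rule: rev_induct)
  case (snoc b x)
  then have "(u @ x) @ [b, a] @ y \<in> L" by simp
  then have "(u @ x) @ [a, b] @ y \<in> L" using assms(1) unfolding commutative_lang_def by blast
  then show ?case using snoc.IH[of "b # y"] by simp
qed simp

text \<open>The first letter of the target is moved to the front by adjacent swaps; the prefix u
  holds what is already in place.\<close>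

lemma commutative_mset_eq:
  assumes "commutative_lang L" and "u @ w \<in> L" and "mset w = mset w'"
  shows "u @ w' \<in> L"
  using assms(2,3)
proof (induction w' arbitrary: u w)
  case (Cons a w')
  then have "a \<in> set w" by (metis list.set_intros(1) set_mset_mset)
  then obtain x y where w: "w = x @ a # y" by (meson split_list)
  then have "(u @ [a]) @ (x @ y) \<in> L" using commutative_move_front[OF assms(1)] Cons.prems by simp
  moreover have "mset (x @ y) = mset w'" using Cons.prems w by simp
  ultimately show ?case using Cons.IH by fastforce
qed simp

section \<open>Candidate words as numbers in base D\<close>

lemma ex_digits:
  assumes "\<forall>a<k. c a < D"
  shows "\<exists>g < D ^ k. \<forall>a<k. g div D ^ a mod D = (c a :: nat)"
  using assms
proof (induction k arbitrary: c)
  case (Suc k)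
  then have "\<forall>a<k. c (Suc a) < D" by simp
  then obtain g where g: "g < D ^ k" "\<forall>a<k. g div D ^ a mod D = c (Suc a)"
    using Suc.IH[of "\<lambda>a. c (Suc a)"] by blast
  have D: "0 < D" "c 0 < D" using Suc.prems by (auto intro: gr0I)
  have "c 0 + D * g < D * (g + 1)" using D by simp
  also have "\<dots> \<le> D * D ^ k" using g by (intro mult_le_mono2) simp
  finally have "c 0 + D * g < D ^ Suc k" by simp
  moreover have "(c 0 + D * g) div D ^ a mod D = c a" if "a < Suc k" for a
  proof (cases a)
    case 0
    then show ?thesis using D by simp
  next
    case (Suc b)
    have "(c 0 + D * g) div D ^ a = ((c 0 + D * g) div D) div D ^ b"
      by (simp add: Suc div_mult2_eq)
    then show ?thesis using Suc that g D by simp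
  qed
  ultimately show ?case by blast
qed simp

definition digit_word :: "nat \<Rightarrow> nat \<Rightarrow> nat \<Rightarrow> nat list" where
  "digit_word D k g = sorted_word (\<lambda>a. g div D ^ a mod D) k"

text \<open>Here g is unbounded: every number yields a word over the alphabet, so any success of the
  search is a genuine witness.\<close>

lemma digit_word_nonempty:
  "\<forall>A\<in>set As. digit_word D k g \<in> nfa_lang A \<Longrightarrow> intersection_nonempty (k, As)"
  using sorted_word_in_lists[of _ k] by (force simp: intersection_nonempty_def digit_word_def)

text \<open>Counts are capped at D - 1, the largest digit; this is why the threshold is strictly
  below D. The cap does not depend on the automaton, so all of them accept the same word.\<close>

lemma nonempty_digit_word:
  assumes "promise (k, As)" and D: "\<forall>A\<in>set As. 2 * fst A * fst A < D" "0 < D"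
    and "intersection_nonempty (k, As)"
  shows "\<exists>g < D ^ k. \<forall>A\<in>set As. digit_word D k g \<in> nfa_lang A"
proof -
  obtain w where w: "w \<in> lists (alphabet k)" "\<forall>A\<in>set As. w \<in> nfa_lang A"
    using assms by (auto simp: intersection_nonempty_def)
  define c where "c = count (mset w)"
  define c' where "c' = (\<lambda>a. min (c a) (D - 1))"
  have "\<forall>a<k. c' a < D" using D(2) by (auto simp: c'_def)
  then obtain g where g: "g < D ^ k" "\<forall>a<k. g div D ^ a mod D = c' a"
    using ex_digits by blast
  have word: "digit_word D k g = sorted_word c' k"
    using g by (auto simp: digit_word_def sorted_word_def intro!: arg_cong[where f = concat])
  have "mset w = mset (sorted_word c k)"
  proof (rule multiset_eqI)
    fix a show "count (mset w) a = count (mset (sorted_word c k)) a"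
      using w(1) by (auto simp: count_sorted_word c_def alphabet_def count_mset_0_iff)
  qed
  have "digit_word D k g \<in> nfa_lang A" if A: "A \<in> set As" for A
  proof -
    obtain n \<delta> q0 F where A': "A = (n, \<delta>, q0, F)" by (metis prod_cases4)
    have p: "wf_nfa k A" "totally_star_free k A" "commutative_lang (nfa_lang A)"
      using assms(1) A by (auto simp: promise_def)
    have "sorted_word c k \<in> nfa_lang A"
      using commutative_mset_eq[OF p(3), of "[]" w] w(2) A \<open>mset w = _\<close> by simp
    then obtain f where f: "f \<in> set F" "nfa_path \<delta> q0 (sorted_word c k) f"
      by (auto simp: A' nfa_lang_def nfa_lang_from_def)
    have "2 * n * n < D" using D(1) A A' by auto
    then have "2 * n * n \<le> D - 1" by simp
    moreover have "q0 < n" using p(1) by (simp add: A' wf_nfa_def)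
    ultimately have "nfa_path \<delta> q0 (sorted_word c' k) f"
      using nfa_path_sorted_word_cap[OF p(1,2)[unfolded A'] _ _ f(2)] unfolding c'_def by blast
    then show ?thesis using f(1) by (auto simp: word A' nfa_lang_def nfa_lang_from_def)
  qed
  then show ?thesis using g(1) by blast
qed

section \<open>The decision procedure\<close>

text \<open>Total correctness. The counter n, the time already spent, is handed on to the
  postcondition, so that sequencing becomes composition of \<open>wp\<close> and time bounds are
  part of the invariants.\<close>

definition wp :: "pcom \<Rightarrow> (nat \<Rightarrow> (nat \<Rightarrow> nat) \<Rightarrow> (nat \<Rightarrow> nat set) \<Rightarrow> bool) \<Rightarrow>
    nat \<Rightarrow> (nat \<Rightarrow> nat) \<Rightarrow> (nat \<Rightarrow> nat set) \<Rightarrow> bool" where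
  "wp c Q n v A \<longleftrightarrow> (\<exists>m v' A'. pexec c v A m v' A' \<and> Q (n + m) v' A')"

lemma wp_mono:
  "wp c Q' n v A \<Longrightarrow> (\<And>n v A. Q' n v A \<Longrightarrow> Q n v A) \<Longrightarrow> wp c Q n v A"
  unfolding wp_def by blast

inductive_cases pexecE:
  "pexec Skip v A n v' A'" "pexec (Inc p) v A n v' A'" "pexec (Dec p) v A n v' A'"
  "pexec (Copy p q) v A n v' A'" "pexec (Put f p) v A n v' A'" "pexec (Del f p) v A n v' A'"
  "pexec (c1 ;; c2) v A n v' A'" "pexec (PIf P p c1 c2) v A n v' A'"

lemma wp_simps [simp]:
  "wp Skip Q n v A \<longleftrightarrow> Q (n + 1) v A"
  "wp (Inc p) Q n v A \<longleftrightarrow> Q (n + 1) (v(p := Suc (v p))) A"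
  "wp (Dec p) Q n v A \<longleftrightarrow> 0 < v p \<and> Q (n + 1) (v(p := v p - 1)) A"
  "wp (Copy p q) Q n v A \<longleftrightarrow> Q (n + 1) (v(p := v q)) A"
  "wp (Put f p) Q n v A \<longleftrightarrow> Q (n + 1) v (A(f := insert (v p) (A f)))"
  "wp (Del f p) Q n v A \<longleftrightarrow> Q (n + 1) v (A(f := A f - {v p}))"
  unfolding wp_def by (auto elim!: pexecE intro!: exI intro: pexec.intros)

lemma wp_Seq [simp]: "wp (c1 ;; c2) Q = wp c1 (wp c2 Q)"
proof (intro ext iffI)
  fix n v A
  assume "wp (c1 ;; c2) Q n v A"
  then show "wp c1 (wp c2 Q) n v A"
    unfolding wp_def by (fastforce elim!: pexecE simp: add.assoc)
next
  fix n v A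
  assume "wp c1 (wp c2 Q) n v A"
  then show "wp (c1 ;; c2) Q n v A"
    unfolding wp_def by (metis pexec_Seq add.assoc)
qed

lemma pexec_If_iff: "pexec (PIf P p c1 c2) v A m v' A' \<longleftrightarrow>
    (\<exists>m'. m = Suc m' \<and> (if P (flag v A (v p)) then pexec c1 v A m' v' A' else pexec c2 v A m' v' A'))"
  by (auto elim!: pexecE intro: pexec_IfT pexec_IfF split: if_splits)

lemma wp_If [simp]: "wp (PIf P p c1 c2) Q n v A \<longleftrightarrow>
    (if P (flag v A (v p)) then wp c1 Q (n + 1) v A else wp c2 Q (n + 1) v A)"
  unfolding wp_def pexec_If_iff by (cases "P (flag v A (v p))") (simp_all, (metis add_Suc_right)+)

text \<open>The number m of rounds is fixed in advance, which settles termination, and the invariant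
  is indexed by the round so that it can bound the time.\<close>

lemma wp_while:
  assumes "I 0 n v A"
    and "\<And>i n v A. i < m \<Longrightarrow> I i n v A \<Longrightarrow> P (flag v A (v p)) \<and> wp c (I (Suc i)) (n + 1) v A"
    and "\<And>n v A. I m n v A \<Longrightarrow> \<not> P (flag v A (v p)) \<and> Q (n + 1) v A"
  shows "wp (PWhile P p c) Q n v A"
proof -
  have "i \<le> m \<Longrightarrow> I i n v A \<Longrightarrow> wp (PWhile P p c) Q n v A" for i n v A
  proof (induction "m - i" arbitrary: i n v A)
    case 0
    then show ?case using assms(3)[of n v A] unfolding wp_def by (fastforce intro: pexec_WhileF)
  next
    case (Suc k)
    then have "P (flag v A (v p))" "wp c (I (Suc i)) (n + 1) v A" using assms(2)[of i n v A] by auto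
    then obtain l v' A' where 1: "pexec c v A l v' A'" "I (Suc i) (n + 1 + l) v' A'"
      unfolding wp_def by blast
    then have "wp (PWhile P p c) Q (n + 1 + l) v' A'" using Suc by (intro Suc.hyps(1)[of "Suc i"]) auto
    then obtain l' v'' A'' where 2: "pexec (PWhile P p c) v' A' l' v'' A''" "Q (n + 1 + l + l') v'' A''"
      unfolding wp_def by blast
    have "n + 1 + l + l' = n + Suc (l + l')" by simp
    then show ?case using pexec_WhileT[where P = P, OF \<open>P (flag v A (v p))\<close> 1(1) 2(1)] 2(2) unfolding wp_def by metis
  qed
  then show ?thesis using assms(1) by blast
qed

section \<open>Frame conditions, input symbols and bounds for nested loops\<close>

definition same_except :: "nat set \<Rightarrow> (nat \<Rightarrow> nat) \<Rightarrow> (nat \<Rightarrow> nat) \<Rightarrow> bool" where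
  "same_except X v v' \<longleftrightarrow> (\<forall>r. r \<notin> X \<longrightarrow> v' r = v r)"

definition input_tape :: "nat list \<Rightarrow> (nat \<Rightarrow> nat set) \<Rightarrow> bool" where
  "input_tape w A \<longleftrightarrow> A 0 = input_sets w 0 \<and> A 1 = input_sets w 1"

lemma drop_Cons_nth: "drop i w = x # xs \<Longrightarrow> i < length w \<and> w ! i = x \<and> drop (Suc i) w = xs"
  by (metis Cons_nth_drop_Suc drop_eq_Nil2 linorder_not_le list.inject list.simps(3))

lemma input_tape_Cons:
  assumes "input_tape w A" and "drop i w = x # xs"
  shows "i \<in> A 0 \<longleftrightarrow> bit x 0" "i \<in> A (Suc 0) \<longleftrightarrow> bit x 1" "drop (Suc i) w = xs"
  using assms drop_Cons_nth[OF assms(2)] by (auto simp: input_tape_def input_sets_def)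

lemma input_tape_Nil:
  assumes "input_tape w A" and "drop i w = []"
  shows "i \<notin> A 0" "i \<notin> A (Suc 0)"
  using assms by (auto simp: input_tape_def input_sets_def)

lemma symbol_bits [simp]: "bit (Suc 0) 0" "\<not> bit (Suc 0) (Suc 0)" "\<not> bit (2::nat) 0" "bit (2::nat) (Suc 0)"
  "bit (3::nat) 0" "bit (3::nat) (Suc 0)"
  by (simp_all add: bit_iff_odd)

text \<open>Each nesting level of loops multiplies the bound by U; lower powers are absorbed by the
  next one.\<close>

lemma powers_mono: 
  assumes "1 \<le> (U::nat)"
  shows "1 \<le> U" "U \<le> U ^ 2" "U ^ 2 \<le> U ^ 3" "U ^ 3 \<le> U ^ 4" "U ^ 4 \<le> U ^ 5" "U ^ 5 \<le> U ^ 6"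
  using assms power_increasing[of 1 2 U] power_increasing[of 2 3 U] power_increasing[of 3 4 U]
    power_increasing[of 4 5 U] power_increasing[of 5 6 U] by simp_all

lemma mult_powers:
  fixes U :: nat
  shows "U * (c * U ^ 2) = c * U ^ 3" "U * (c * U ^ 3) = c * U ^ 4"
    "U * (c * U ^ 4) = c * U ^ 5" "U * (c * U ^ 5) = c * U ^ 6"
  by (simp_all add: eval_nat_numeral algebra_simps)

text \<open>Pointers: 4 zero; 5 reading position; 6 alphabet size k; 7 number of states of the current
  automaton; 8, 9, 10 the transition just read (10 also the initial or a final state just read);
  11 current letter; 12 start of the transition list; 13 base D; 14 index g of the candidate word;
  15, 16, 17 remaining digits of g, quotient, current digit; 18, 26 loop counters; 19 acceptance
  by the current automaton; 20 some automaton rejected; 21 g exceeds the last candidate; 22 result;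
  23 termination; 24 input length; 25 start of the first automaton. Set 2 holds the reached states
  and set 3 is scratch space for their successors.\<close>

definition read_num :: "nat \<Rightarrow> pcom" where
  "read_num r = Copy r 4 ;; PWhile (\<lambda>b. \<not> b 1) 5 (Inc 5 ;; Inc r) ;; Inc 5"

text \<open>Symbol 1 has bit 1 unset and the delimiter 2 has it set, so the loop counts the ones and
  the final \<open>Inc\<close> passes the delimiter. The delimiter also gives m < U, which absorbs
  the constants in the time bound.\<close>

lemma wp_read_num:
  assumes tape: "input_tape w A" and pos: "drop (v 5) w = enc_nat m @ xs"
    and r: "r \<noteq> 4" "r \<noteq> 5" "v 4 = 0" and U: "length w \<le> U"
  shows "wp (read_num r) (\<lambda>n' v' A'. n' \<le> n + 6 * U \<and> A' = A \<and> same_except {5, r} v v' \<and>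
     v' r = m \<and> drop (v' 5) w = xs) n v A"
proof -
  have "length (drop (v 5) w) \<le> length w" by simp
  then have m: "m < U" using U unfolding pos by (simp add: enc_nat_def)
  show ?thesis unfolding read_num_def wp_Seq wp_simps
  proof (rule wp_while[where m = m and I = "\<lambda>i n' v' A'. n' = n + 1 + 3 * i \<and> A' = A \<and>
      same_except {5, r} v v' \<and> v' r = i \<and> drop (v' 5) w = replicate (m - i) 1 @ [2] @ xs"], goal_cases)
    case 1
    then show ?case using pos r by (auto simp: same_except_def enc_nat_def)
  next
    case (2 i n' v' A')
    then have A: "A' = A" and "drop (v' 5) w = 1 # replicate (m - Suc i) 1 @ [2] @ xs"
      by (auto simp: Suc_diff_Suc simp flip: replicate_Suc)
    from input_tape_Cons[OF tape this(2)] show ?case using 2 r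
      by (auto simp: flag_def A same_except_def)
  next
    case (3 n' v' A')
    then have A: "A' = A" and "drop (v' 5) w = 2 # xs" by auto
    from input_tape_Cons[OF tape this(2)] show ?case using 3 r m
      by (auto simp: flag_def A same_except_def)
  qed
qed


section \<open>One letter of the subset simulation\<close>

definition enc_trans :: "(nat \<times> nat \<times> nat) list \<Rightarrow> nat list" where
  "enc_trans \<delta> = concat (map (\<lambda>(p, a, q). enc_nat p @ enc_nat a @ enc_nat q) \<delta>)"

lemma enc_trans_drop:
  "i < length \<delta> \<Longrightarrow> \<delta> ! i = (p, a, q) \<Longrightarrow>
     enc_trans (drop i \<delta>) = enc_nat p @ enc_nat a @ enc_nat q @ enc_trans (drop (Suc i) \<delta>)"
  by (simp add: enc_trans_def flip: Cons_nth_drop_Suc)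

lemma length_enc_trans: "length \<delta> \<le> length (enc_trans \<delta>)"
  by (induction \<delta>) (auto simp: enc_trans_def enc_nat_def)

text \<open>The loops are steered by the next symbol: 1 or 2 opens a number, 3 has both bits and
  closes a list, a blank has none and ends the input.\<close>

definition starts_number :: "nat list \<Rightarrow> bool" where
  "starts_number xs \<longleftrightarrow> (\<exists>x ys. xs = x # ys \<and> (x = 1 \<or> x = 2))"

lemma starts_number_enc_nat: "starts_number (enc_nat m @ xs)"
  by (cases m) (auto simp: starts_number_def enc_nat_def)

lemma input_tape_starts_number:
  assumes "input_tape w A" and "drop i w = xs" and "starts_number xs"
  shows "\<not> (i \<in> A 0 \<and> i \<in> A (Suc 0))" "i \<in> A 0 \<or> i \<in> A (Suc 0)"
  using assms input_tape_Cons[OF assms(1)] unfolding starts_number_def by auto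

definition successors :: "(nat \<times> nat \<times> nat) list \<Rightarrow> nat \<Rightarrow> nat set \<Rightarrow> nat set" where
  "successors \<delta> a S = {q. \<exists>p\<in>S. (p, a, q) \<in> set \<delta>}"

lemma successors_take_Suc:
  "i < length \<delta> \<Longrightarrow> \<delta> ! i = (p, b, q) \<Longrightarrow>
     successors (take (Suc i) \<delta>) a S = (if b = a \<and> p \<in> S then insert q (successors (take i \<delta>) a S)
       else successors (take i \<delta>) a S)"
  by (auto simp: successors_def take_Suc_conv_app_nth)

text \<open>The successors are collected in set 3, because set 2 has to remain the old set until all
  transitions are scanned; a sweep then moves set 3 into set 2 and empties set 3.\<close>

definition step_code :: pcom where
  "step_code = Copy 5 12 ;;
     PWhile (\<lambda>b. \<not> (b 0 \<and> b 1)) 5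
       (read_num 8 ;; read_num 9 ;; read_num 10 ;;
        PIf (\<lambda>b. b 11) 9 (PIf (\<lambda>b. b 2) 8 (Put 3 10) Skip) Skip) ;;
     Copy 18 4 ;;
     PWhile (\<lambda>b. \<not> b 7) 18
       (PIf (\<lambda>b. b 3) 18 (Put 2 18 ;; Del 3 18) (Del 2 18) ;; Inc 18)"

lemma wp_step_scan:
  assumes tape: "input_tape w A" and pos: "drop (v 5) w = enc_trans \<delta> @ 3 # xs"
    and v: "v 4 = 0" "A 3 = {}" and U: "length w \<le> U" "1 \<le> U"
  shows "wp (PWhile (\<lambda>b. \<not> (b 0 \<and> b 1)) 5
       (read_num 8 ;; read_num 9 ;; read_num 10 ;;
        PIf (\<lambda>b. b 11) 9 (PIf (\<lambda>b. b 2) 8 (Put 3 10) Skip) Skip))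
     (\<lambda>n' v' A'. n' \<le> n + 22 * U ^ 2 + 1 \<and> A' = A(3 := successors \<delta> (v 11) (A 2)) \<and>
        same_except {5, 8, 9, 10} v v') n v A"
proof -
  have "length (drop (v 5) w) \<le> length w" by simp
  then have len: "length \<delta> \<le> U" using U length_enc_trans[of \<delta>] unfolding pos by simp
  show ?thesis
  proof (rule wp_while[where m = "length \<delta>" and I = "\<lambda>i n' v' A'. n' \<le> n + i * (22 * U) \<and>
      A' = A(3 := successors (take i \<delta>) (v 11) (A 2)) \<and> same_except {5, 8, 9, 10} v v' \<and>
      drop (v' 5) w = enc_trans (drop i \<delta>) @ 3 # xs"], goal_cases)
    case 1
    then show ?case using pos v by (auto simp: same_except_def successors_def fun_eq_iff)
  next
    case (2 i n' v' A')
    obtain p a q where t: "\<delta> ! i = (p, a, q)" by (metis prod_cases3)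
    have tape': "input_tape w A'" using tape 2 by (auto simp: input_tape_def)
    have pos': "drop (v' 5) w = enc_nat p @ enc_nat a @ enc_nat q @ enc_trans (drop (Suc i) \<delta>) @ 3 # xs"
      using 2 t enc_trans_drop by simp
    have v4: "v' 4 = 0" "v' 11 = v 11" using 2 v by (auto simp: same_except_def)
    have "\<not> (v' 5 \<in> A' 0 \<and> v' 5 \<in> A' (Suc 0))"
      using input_tape_starts_number[OF tape' pos'] starts_number_enc_nat by simp
    moreover have "wp (read_num 8 ;; read_num 9 ;; read_num 10 ;;
        PIf (\<lambda>b. b 11) 9 (PIf (\<lambda>b. b 2) 8 (Put 3 10) Skip) Skip) (\<lambda>n' v' A'. n' \<le> n + Suc i * (22 * U) \<and>
      A' = A(3 := successors (take (Suc i) \<delta>) (v 11) (A 2)) \<and> same_except {5, 8, 9, 10} v v' \<and>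
      drop (v' 5) w = enc_trans (drop (Suc i) \<delta>) @ 3 # xs) (n' + 1) v' A'"
      unfolding wp_Seq
    proof (rule wp_mono[OF wp_read_num[OF tape' pos' _ _ v4(1) U(1)]], simp, simp, goal_cases)
      case (1 n1 v1 A1)
      then have "input_tape w A1" "v1 4 = 0" "v1 11 = v 11" "v1 8 = p"
        "drop (v1 5) w = enc_nat a @ enc_nat q @ enc_trans (drop (Suc i) \<delta>) @ 3 # xs" using tape' v4 by (auto simp: same_except_def)
      note 11 = this
      show ?case
      proof (rule wp_mono[OF wp_read_num[OF 11(1,5) _ _ 11(2) U(1)]], simp, simp, goal_cases)
        case (1 n2 v2 A2)
        then have "input_tape w A2" "v2 4 = 0" "v2 11 = v 11" "v2 8 = p" "v2 9 = a"
          "drop (v2 5) w = enc_nat q @ enc_trans (drop (Suc i) \<delta>) @ 3 # xs" using 11 by (auto simp: same_except_def)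
        note 22 = this
        show ?case
        proof (rule wp_mono[OF wp_read_num[OF 22(1,6) _ _ 22(2) U(1)]], simp, simp, goal_cases)
          case (1 n3 v3 A3)
          then have "v3 11 = v 11" "v3 8 = p" "v3 9 = a" "v3 10 = q" using 22 by (auto simp: same_except_def)
          moreover have "same_except {5, 8, 9, 10} v v3"
            using 1 \<open>n1 \<le> _ \<and> _\<close> \<open>n2 \<le> _ \<and> _\<close> 2 by (auto simp: same_except_def)
          moreover have "A3 = A'" using 1 \<open>n1 \<le> _ \<and> _\<close> \<open>n2 \<le> _ \<and> _\<close> by simp
          \<comment> \<open>Three numbers cost at most 18 * U; the loop test, two conditionals and
            \<open>Put\<close> add 4.\<close>
          moreover have "n3 + 3 \<le> n + Suc i * (22 * U)"
            using 1 \<open>n1 \<le> _ \<and> _\<close> \<open>n2 \<le> _ \<and> _\<close> 2 U by simp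
          ultimately show ?case using 1 2 t successors_take_Suc[OF _ t, of "v 11" "A 2"]
            by (auto simp: flag_def)
        qed
      qed
    qed
    ultimately show ?case by (simp add: flag_def)
  next
    case (3 n' v' A')
    then have tape': "input_tape w A'" using tape by (auto simp: input_tape_def)
    have "drop (v' 5) w = 3 # xs" using 3 by (simp add: enc_trans_def)
    note input_tape_Cons[OF tape' this]
    moreover have "length \<delta> * (22 * U) \<le> 22 * U ^ 2" using len by (simp add: power2_eq_square)
    ultimately show ?case using 3 by (auto simp: flag_def)
  qed
qed

text \<open>Below i the new set has arrived, from i on the old one is still there. The sweep covers
  only positions below \<open>v 7\<close>, so both sets are confined to them.\<close>

lemma wp_step_copy:
  assumes v: "v 18 = 0" and S: "A 2 \<subseteq> {..<v 7}" "A 3 \<subseteq> {..<v 7}" and U: "v 7 \<le> U"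
  shows "wp (PWhile (\<lambda>b. \<not> b 7) 18
       (PIf (\<lambda>b. b 3) 18 (Put 2 18 ;; Del 3 18) (Del 2 18) ;; Inc 18))
     (\<lambda>n' v' A'. n' \<le> n + 5 * U + 1 \<and> A' = A(2 := A 3, 3 := {}) \<and> same_except {18} v v') n v A"
proof (rule wp_while[where m = "v 7" and I = "\<lambda>i n' v' A'. n' \<le> n + i * 5 \<and>
    A' = A(2 := (A 2 \<inter> {i..}) \<union> (A 3 \<inter> {..<i}), 3 := A 3 \<inter> {i..}) \<and> same_except {18} v v' \<and> v' 18 = i"], goal_cases)
  case 1
  show ?case using v by (auto simp: same_except_def fun_upd_idem_iff)
next
  case (2 i n' v' A')
  then have v': "v' 7 = v 7" "v' 18 = i" by (auto simp: same_except_def)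
  have sets: "A 2 \<inter> {Suc i..} \<union> A 3 \<inter> {..<Suc i} =
       (if i \<in> A 3 then insert i (A 2 \<inter> {i..} \<union> A 3 \<inter> {..<i}) else A 2 \<inter> {i..} \<union> A 3 \<inter> {..<i} - {i})"
     "A 3 \<inter> {Suc i..} = (if i \<in> A 3 then A 3 \<inter> {i..} - {i} else A 3 \<inter> {i..})"
    by (auto simp: less_Suc_eq Suc_le_eq order_le_less)
  show ?case using 2 v' unfolding sets
    by (auto simp: flag_def same_except_def fun_eq_iff)
next
  case (3 n' v' A')
  then have "v' 7 = v' 18" by (auto simp: same_except_def)
  moreover have "A 2 \<inter> {v 7..} \<union> A 3 \<inter> {..<v 7} = A 3" "A 3 \<inter> {v 7..} = {}" using S by auto
  moreover have "v 7 * 5 \<le> 5 * U" using U by simp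
  ultimately show ?case using 3 by (auto simp: flag_def)
qed

lemma wp_step_code:
  assumes tape: "input_tape w A" and pos: "drop (v 12) w = enc_trans \<delta> @ 3 # xs"
    and v: "v 4 = 0" "A 3 = {}" "A 2 \<subseteq> {..<v 7}" and \<delta>: "\<forall>(p, a, q) \<in> set \<delta>. q < v 7"
    and U: "length w \<le> U" "1 \<le> U" "v 7 \<le> U"
  shows "wp step_code (\<lambda>n' v' A'. n' \<le> n + 31 * U ^ 2 \<and> A' = A(2 := successors \<delta> (v 11) (A 2)) \<and>
     same_except {5, 8, 9, 10, 18} v v') n v A"
  unfolding step_code_def wp_Seq wp_simps
proof (rule wp_mono[OF wp_step_scan[OF tape _ _ v(2) U(1,2), where xs = xs and \<delta> = \<delta>]], goal_cases)
  case (3 n' v' A')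
  have succ: "successors \<delta> (v 11) (A 2) \<subseteq> {..<v 7}" using \<delta> by (auto simp: successors_def)
  have v': "v' 4 = 0" "v' 7 = v 7" using 3 v by (auto simp: same_except_def)
  show ?case
  proof (rule wp_mono[OF wp_step_copy[where U = U]], goal_cases)
    case (5 n2 v2 A2)
    moreover have "A(3 := {}) = A" using v by (simp add: fun_upd_idem)
    moreover have "n2 \<le> n + 31 * U ^ 2" using 3 5 U powers_mono[OF U(2)] by simp
    ultimately show ?case using 3 by (auto simp: same_except_def fun_upd_twist)
  qed (use 3 v' succ v U in auto)
qed (use pos v in auto)

section \<open>Digits of a candidate\<close>

definition divmod_code :: pcom where
  "divmod_code = Copy 16 4 ;; Copy 17 4 ;; Copy 18 4 ;;
     PWhile (\<lambda>b. \<not> b 15) 18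
       (Inc 18 ;; Inc 17 ;; PIf (\<lambda>b. b 13) 17 (Copy 17 4 ;; Inc 16) Skip) ;;
     Copy 15 16"

text \<open>Division by counting: pointer 18 runs up to the dividend while 16 and 17 keep quotient
  and remainder of its position, the remainder wrapping at the base. The quotient goes back to
  pointer 15, ready for the next digit.\<close>

lemma wp_divmod_code:
  assumes v: "v 4 = 0" "0 < v 13" and U: "v 15 \<le> U" "1 \<le> U"
  shows "wp divmod_code (\<lambda>n' v' A'. n' \<le> n + 11 * U \<and> A' = A \<and>
     same_except {15, 16, 17, 18} v v' \<and> v' 15 = v 15 div v 13 \<and> v' 17 = v 15 mod v 13) n v A"
  unfolding divmod_code_def wp_Seq wp_simps
proof (rule wp_while[where m = "v 15" and I = "\<lambda>i n' v' A'. n' \<le> n + 3 + i * 6 \<and> A' = A \<and>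
    same_except {16, 17, 18} v v' \<and> v' 18 = i \<and> v' 16 = i div v 13 \<and> v' 17 = i mod v 13"], goal_cases)
  case 1
  show ?case using v by (auto simp: same_except_def)
next
  case (2 i n' v' A')
  then have v': "v' 4 = 0" "v' 13 = v 13" "v' 15 = v 15" using v by (auto simp: same_except_def)
  then show ?case using 2 v by (auto simp: flag_def same_except_def mod_Suc div_Suc)
next
  case (3 n' v' A')
  then have v': "v' 15 = v 15" by (auto simp: same_except_def)
  then show ?case using 3 U by (auto simp: flag_def same_except_def)
qed

definition reach :: "(nat \<times> nat \<times> nat) list \<Rightarrow> nat \<Rightarrow> nat list \<Rightarrow> nat set" where
  "reach \<delta> q0 w = {p. nfa_path \<delta> q0 w p}"

lemma reach_simps: "reach \<delta> q0 [] = {q0}" "successors \<delta> a (reach \<delta> q0 w) = reach \<delta> q0 (w @ [a])"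
  by (auto simp: reach_def successors_def nfa_path_append)

lemma reach_bound: "wf_nfa k (n, \<delta>, q0, F) \<Longrightarrow> reach \<delta> q0 w \<subseteq> {..<n}"
proof
  fix p assume wf: "wf_nfa k (n, \<delta>, q0, F)" and "p \<in> reach \<delta> q0 w"
  then have "nfa_path \<delta> q0 w p" "q0 < n" by (simp_all add: reach_def wf_nfa_def)
  then show "p \<in> {..<n}" using nfa_path_state[OF wf] by simp
qed

lemma wp_letter_loop:
  assumes tape: "input_tape w A" and pos: "drop (v 12) w = enc_trans \<delta> @ 3 # xs"
    and v: "v 4 = 0" "A 3 = {}" "A 2 = reach \<delta> q0 u"
    and wf: "wf_nfa k (v 7, \<delta>, q0, F)"
    and U: "length w \<le> U" "1 \<le> U" "v 7 \<le> U" "v 17 \<le> U"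
  shows "wp (PWhile (\<lambda>b. \<not> b 4) 17 (step_code ;; Dec 17)) (\<lambda>n' v' A'. n' \<le> n + 33 * U ^ 3 + 1 \<and>
     A' = A(2 := reach \<delta> q0 (u @ replicate (v 17) (v 11))) \<and> same_except {5, 8, 9, 10, 17, 18} v v') n v A"
proof (rule wp_while[where m = "v 17" and I = "\<lambda>i n' v' A'. n' \<le> n + i * (33 * U ^ 2) \<and>
    A' = A(2 := reach \<delta> q0 (u @ replicate i (v 11))) \<and> same_except {5, 8, 9, 10, 17, 18} v v' \<and>
    v' 17 = v 17 - i"], goal_cases)
  case 1
  show ?case using v by (auto simp: same_except_def fun_eq_iff)
next
  case (2 i n' v' A')
  then have v': "v' 4 = 0" "v' 7 = v 7" "v' 12 = v 12" "v' 11 = v 11" using v by (auto simp: same_except_def)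
  have "wp step_code (wp (Dec 17) (\<lambda>n' v' A'. n' \<le> n + Suc i * (33 * U ^ 2) \<and>
    A' = A(2 := reach \<delta> q0 (u @ replicate (Suc i) (v 11))) \<and> same_except {5, 8, 9, 10, 17, 18} v v' \<and>
    v' 17 = v 17 - Suc i)) (n' + 1) v' A'"
  proof (rule wp_mono[OF wp_step_code[where w = w and \<delta> = \<delta> and xs = xs and U = U]], goal_cases)
    case (10 n2 v2 A2)
    have "u @ replicate i (v 11) @ [v 11] = u @ replicate (Suc i) (v 11)"
      by (simp add: replicate_append_same)
    then show ?case using 10 2 v' powers_mono[OF U(2)]
      by (auto simp: same_except_def reach_simps)
  qed (use 2 v' v tape pos U reach_bound[OF wf] wf in \<open>auto simp: input_tape_def wf_nfa_def\<close>)
  then show ?case using 2 v' by (simp add: flag_def)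
next
  case (3 n' v' A')
  then have "v' 4 = v' 17" using v by (auto simp: same_except_def)
  moreover have "v 17 * (33 * U ^ 2) \<le> 33 * U ^ 3"
    using mult_le_mono1[OF U(4), of "33 * U ^ 2"] by (simp only: mult_powers)
  ultimately show ?case using 3 by (auto simp: flag_def)
qed

definition letters_code :: pcom where
  "letters_code = Copy 15 14 ;; Copy 11 4 ;;
     PWhile (\<lambda>b. \<not> b 6) 11 (divmod_code ;; PWhile (\<lambda>b. \<not> b 4) 17 (step_code ;; Dec 17) ;; Inc 11)"

lemma digit_word_simps: "digit_word D 0 g = []"
  "digit_word D (Suc a) g = digit_word D a g @ replicate (g div D ^ a mod D) a"
  by (simp_all add: digit_word_def)

text \<open>Pointer 15 ends with what is left of g after k digits, which is nonzero exactly if g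
  \<ge> D^k. This is the overflow test of the search.\<close>

lemma wp_letters_code:
  assumes tape: "input_tape w A" and pos: "drop (v 12) w = enc_trans \<delta> @ 3 # xs"
    and v: "v 4 = 0" "A 3 = {}" "A 2 = {q0}" "0 < v 13"
    and wf: "wf_nfa k (v 7, \<delta>, q0, F)"
    and U: "length w \<le> U" "1 \<le> U" "v 7 \<le> U" "v 13 \<le> U" "v 14 \<le> U" "v 6 \<le> U"
  shows "wp letters_code (\<lambda>n' v' A'. n' \<le> n + 50 * U ^ 4 \<and>
     A' = A(2 := reach \<delta> q0 (digit_word (v 13) (v 6) (v 14))) \<and> v' 15 = v 14 div v 13 ^ v 6 \<and>
     same_except {5, 8, 9, 10, 11, 15, 16, 17, 18} v v') n v A"
  unfolding letters_code_def wp_Seq wp_simps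
proof (rule wp_while[where m = "v 6" and I = "\<lambda>i n' v' A'. n' \<le> n + 2 + i * (47 * U ^ 3) \<and>
    A' = A(2 := reach \<delta> q0 (digit_word (v 13) i (v 14))) \<and> v' 11 = i \<and> v' 15 = v 14 div v 13 ^ i \<and>
    same_except {5, 8, 9, 10, 11, 15, 16, 17, 18} v v'"], goal_cases)
  case 1
  show ?case using v by (auto simp: same_except_def reach_simps digit_word_simps fun_eq_iff)
next
  case (2 i n' v' A')
  then have v': "v' 4 = 0" "v' 6 = v 6" "v' 7 = v 7" "v' 12 = v 12" "v' 13 = v 13"
    using v by (auto simp: same_except_def)
  have "v 14 div v 13 ^ i \<le> v 14" by (rule div_le_dividend)
  then have le: "v 14 div v 13 ^ i \<le> U" using U by linarith
  let ?Q = "\<lambda>n' v' A'. n' \<le> n + 2 + Suc i * (47 * U ^ 3) \<and>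
    A' = A(2 := reach \<delta> q0 (digit_word (v 13) (Suc i) (v 14))) \<and> v' 11 = Suc i \<and> v' 15 = v 14 div v 13 ^ Suc i \<and>
    same_except {5, 8, 9, 10, 11, 15, 16, 17, 18} v v'"
  have "wp divmod_code (wp (PWhile (\<lambda>b. \<not> b 4) 17 (step_code ;; Dec 17)) (wp (Inc 11) ?Q)) (n' + 1) v' A'"
  proof (rule wp_mono[OF wp_divmod_code[where U = U]], goal_cases)
    case (5 n1 v1 A1)
    have "v 14 div v 13 ^ Suc i = v 14 div v 13 ^ i div v 13"
      by (simp only: power_Suc2 div_mult2_eq)
    then have v1: "v1 4 = 0" "v1 7 = v 7" "v1 12 = v 12" "v1 11 = i" "v1 17 = v 14 div v 13 ^ i mod v 13"
        "v1 15 = v 14 div v 13 ^ Suc i" "A1 = A'"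
      using 5 v' 2 by (auto simp: same_except_def)
    have "v1 17 \<le> v 13" using v1 v(4) by (simp add: less_imp_le)
    then have v1_17: "v1 17 \<le> U" using U by simp
    have "wp (PWhile (\<lambda>b. \<not> b 4) 17 (step_code ;; Dec 17)) (wp (Inc 11) ?Q) n1 v1 A1"
    proof (rule wp_mono[OF wp_letter_loop[where w = w and \<delta> = \<delta> and xs = xs and U = U and ?q0.0 = q0
          and u = "digit_word (v 13) i (v 14)" and k = k and F = F]], goal_cases)
      case (11 n2 v2 A2)
      have "n2 + 1 \<le> n + 2 + Suc i * (47 * U ^ 3)"
        using 11 5 2 powers_mono[OF U(2)] by simp
      moreover have "same_except {5, 8, 9, 10, 11, 15, 16, 17, 18} v (v2(11 := Suc i))"
        using 11 5 2 by (simp add: same_except_def)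
      moreover have "v2 11 = i" "v2 15 = v 14 div v 13 ^ Suc i" using 11 v1 by (auto simp: same_except_def)
      moreover have "A2 = A(2 := reach \<delta> q0 (digit_word (v 13) (Suc i) (v 14)))"
        using 11 v1 2 by (simp add: digit_word_simps)
      ultimately show ?case by simp
    qed (use v1 v1_17 v' 2 v tape pos U wf in \<open>auto simp: input_tape_def\<close>)
    then show ?case .
  qed (use v' 2 v U le in auto)
  then show ?case using 2 v' by (simp add: flag_def)
next
  case (3 n' v' A')
  then have "v' 6 = v' 11" by (auto simp: same_except_def)
  moreover have "v 6 * (47 * U ^ 3) \<le> 47 * U ^ 4"
    using mult_le_mono1[OF U(6), of "47 * U ^ 3"] by (simp only: mult_powers)
  ultimately show ?case using 3 powers_mono[OF U(2)] by (auto simp: flag_def)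
qed

section \<open>Running one automaton on a candidate\<close>

lemma wp_skip_to_3:
  assumes tape: "input_tape w A" and pos: "drop (v 5) w = us @ 3 # xs"
    and us: "\<forall>x\<in>set us. x = 1 \<or> x = 2" and U: "length w \<le> U"
  shows "wp (PWhile (\<lambda>b. \<not> (b 0 \<and> b 1)) 5 (Inc 5)) (\<lambda>n' v' A'. n' \<le> n + 2 * U + 1 \<and>
     A' = A \<and> same_except {5} v v' \<and> drop (v' 5) w = 3 # xs) n v A"
proof (rule wp_while[where m = "length us" and I = "\<lambda>i n' v' A'. n' = n + 2 * i \<and> A' = A \<and>
     same_except {5} v v' \<and> drop (v' 5) w = drop i us @ 3 # xs"], goal_cases)
  case 1
  show ?case using pos by (simp add: same_except_def)
next
  case (2 i n' v' A')
  then have c: "drop (v' 5) w = us ! i # drop (Suc i) us @ 3 # xs" by (simp flip: Cons_nth_drop_Suc)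
  have "us ! i = 1 \<or> us ! i = 2" using us 2(1) by simp
  then show ?case using 2 input_tape_Cons[OF tape c] by (auto simp: flag_def same_except_def)
next
  case (3 n' v' A')
  have "length (drop (v 5) w) \<le> length w" by simp
  then have "length us \<le> U" using U unfolding pos by simp
  moreover have "drop (v' 5) w = 3 # xs" using 3 by simp
  ultimately show ?case using 3 input_tape_Cons[OF tape, of "v' 5" 3 xs] by (auto simp: flag_def)
qed

lemma wp_finals:
  assumes tape: "input_tape w A" and pos: "drop (v 5) w = concat (map enc_nat F) @ 3 # xs"
    and v: "v 4 = 0" "v 19 = 0" and U: "length w \<le> U" "1 \<le> U"
  shows "wp (PWhile (\<lambda>b. \<not> (b 0 \<and> b 1)) 5 (read_num 10 ;; PIf (\<lambda>b. b 2) 10 (Copy 19 4 ;; Inc 19) Skip))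
     (\<lambda>n' v' A'. n' \<le> n + 10 * U ^ 2 + 1 \<and> A' = A \<and> same_except {5, 10, 19} v v' \<and>
        drop (v' 5) w = 3 # xs \<and> (v' 19 = 0 \<longleftrightarrow> A 2 \<inter> set F = {})) n v A"
proof (rule wp_while[where m = "length F" and I = "\<lambda>i n' v' A'. n' \<le> n + i * (10 * U) \<and> A' = A \<and>
     same_except {5, 10, 19} v v' \<and> drop (v' 5) w = concat (map enc_nat (drop i F)) @ 3 # xs \<and>
     (v' 19 = 0 \<longleftrightarrow> A 2 \<inter> set (take i F) = {})"], goal_cases)
  case 1
  show ?case using pos v by (simp add: same_except_def)
next
  case (2 i n' v' A')
  then have c: "drop (v' 5) w = enc_nat (F ! i) @ concat (map enc_nat (drop (Suc i) F)) @ 3 # xs"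
    by (simp flip: Cons_nth_drop_Suc)
  have v': "v' 4 = 0" using 2 v by (auto simp: same_except_def)
  have tape': "input_tape w A'" using tape 2 by simp
  have "wp (read_num 10) (wp (PIf (\<lambda>b. b 2) 10 (Copy 19 4 ;; Inc 19) Skip) (\<lambda>n' v' A'. n' \<le> n + Suc i * (10 * U) \<and> A' = A \<and>
     same_except {5, 10, 19} v v' \<and> drop (v' 5) w = concat (map enc_nat (drop (Suc i) F)) @ 3 # xs \<and>
     (v' 19 = 0 \<longleftrightarrow> A 2 \<inter> set (take (Suc i) F) = {}))) (n' + 1) v' A'"
  proof (rule wp_mono[OF wp_read_num[OF tape' c _ _ v' U(1)]], simp, simp, goal_cases)
    case (1 n1 v1 A1)
    then have "v1 4 = 0" "v1 19 = v' 19" using v' by (auto simp: same_except_def)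
    then show ?case using 1 2 U by (auto simp: flag_def same_except_def take_Suc_conv_app_nth)
  qed
  then show ?case using input_tape_starts_number[OF tape' c] starts_number_enc_nat by (simp add: flag_def)
next
  case (3 n' v' A')
  have "length (drop (v 5) w) \<le> length w" by simp
  moreover have "length F \<le> length (concat (map enc_nat F))" by (induction F) (auto simp: enc_nat_def)
  ultimately have "length F \<le> U" using U unfolding pos by simp
  then have "length F * (10 * U) \<le> 10 * U ^ 2" by (simp add: power2_eq_square)
  moreover have "drop (v' 5) w = 3 # xs" using 3 by simp
  ultimately show ?case using 3 input_tape_Cons[OF tape, of "v' 5" 3 xs] by (auto simp: flag_def)
qed

lemma wp_clear:
  assumes v: "v 18 = 0" and S: "A 2 \<subseteq> {..<v 7}" and U: "v 7 \<le> U"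
  shows "wp (PWhile (\<lambda>b. \<not> b 7) 18 (Del 2 18 ;; Inc 18))
     (\<lambda>n' v' A'. n' \<le> n + 3 * U + 1 \<and> A' = A(2 := {}) \<and> same_except {18} v v') n v A"
proof (rule wp_while[where m = "v 7" and I = "\<lambda>i n' v' A'. n' \<le> n + i * 3 \<and>
    A' = A(2 := A 2 - {..<i}) \<and> same_except {18} v v' \<and> v' 18 = i"], goal_cases)
  case 1
  show ?case using v by (auto simp: same_except_def)
next
  case (2 i n' v' A')
  then have v': "v' 7 = v 7" by (auto simp: same_except_def)
  have "A 2 - {..<Suc i} = A 2 - {..<i} - {i}" by auto
  then show ?case using 2 v' by (auto simp: flag_def same_except_def)
next
  case (3 n' v' A')
  then have "v' 7 = v' 18" by (auto simp: same_except_def)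
  moreover have clear: "A 2 - {..<v 7} = {}" using S by auto
  ultimately show ?case using 3[unfolded clear] U by (auto simp: flag_def)
qed

definition sim_code :: pcom where
  "sim_code = read_num 7 ;; read_num 10 ;; Copy 12 5 ;; Put 2 10 ;; letters_code ;;
   Copy 5 12 ;; PWhile (\<lambda>b. \<not> (b 0 \<and> b 1)) 5 (Inc 5) ;; Inc 5 ;;
   Copy 19 4 ;;
   PWhile (\<lambda>b. \<not> (b 0 \<and> b 1)) 5 (read_num 10 ;; PIf (\<lambda>b. b 2) 10 (Copy 19 4 ;; Inc 19) Skip) ;;
   Inc 5 ;;
   Copy 18 4 ;; PWhile (\<lambda>b. \<not> b 7) 18 (Del 2 18 ;; Inc 18) ;;
   PIf (\<lambda>b. b 4) 19 (Copy 20 4 ;; Inc 20) Skip ;;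
   PIf (\<lambda>b. b 4) 15 Skip (Copy 21 4 ;; Inc 21)"

abbreviation sim_regs :: "nat set" where
  "sim_regs \<equiv> {5, 7, 8, 9, 10, 11, 12, 15, 16, 17, 18, 19, 20, 21}"

text \<open>The sets are restored, so the next automaton starts afresh; flags 20 and 21 are only
  ever raised here, so they accumulate over the list of automata.\<close>

lemma wp_sim_code:
  assumes tape: "input_tape w A" and pos: "drop (v 5) w = enc_nfa N @ xs"
    and v: "v 4 = 0" "A 3 = {}" "A 2 = {}" "0 < v 13" and wf: "wf_nfa k N"
    and U: "length w \<le> U" "1 \<le> U" "v 13 \<le> U" "v 14 \<le> U" "v 6 \<le> U"
  shows "wp sim_code (\<lambda>n' v' A'. n' \<le> n + 110 * U ^ 4 \<and> A' = A \<and> same_except sim_regs v v' \<and>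
     drop (v' 5) w = xs \<and>
     (v' 20 = 0 \<longleftrightarrow> v 20 = 0 \<and> digit_word (v 13) (v 6) (v 14) \<in> nfa_lang N) \<and>
     (v' 21 = 0 \<longleftrightarrow> v 21 = 0 \<and> v 14 div v 13 ^ v 6 = 0)) n v A"
proof -
  obtain m \<delta> q0 F where N: "N = (m, \<delta>, q0, F)" by (metis prod_cases4)
  define ys where "ys = concat (map enc_nat F) @ 3 # xs"
  let ?g = "digit_word (v 13) (v 6) (v 14)"
  have pos0: "drop (v 5) w = enc_nat m @ enc_nat q0 @ enc_trans \<delta> @ 3 # ys"
    using pos by (simp add: N enc_nfa_def enc_trans_def ys_def)
  have "length (drop (v 5) w) \<le> length w" by simp
  then have m: "m \<le> U" using U unfolding pos0 by (simp add: enc_nat_def)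
  have trans12: "\<forall>x\<in>set (enc_trans \<delta>). x = 1 \<or> x = 2"
    by (auto simp: enc_trans_def enc_nat_def split: if_splits)
  have lang: "?g \<in> nfa_lang N \<longleftrightarrow> reach \<delta> q0 ?g \<inter> set F \<noteq> {}"
    by (auto simp: N nfa_lang_def nfa_lang_from_def reach_def)
  note pw = powers_mono[OF U(2)]
  show ?thesis unfolding sim_code_def wp_Seq
  proof (rule wp_mono[OF wp_read_num[OF tape pos0 _ _ v(1) U(1)]], simp, simp, goal_cases)
    case (1 n1 v1 A1)
    note h1 = this
    then have "input_tape w A1" "drop (v1 5) w = enc_nat q0 @ enc_trans \<delta> @ 3 # ys" "v1 4 = 0"
      using tape v by (auto simp: same_except_def)
    note 2 = this
    show ?case
    proof (rule wp_mono[OF wp_read_num[OF 2(1,2) _ _ 2(3) U(1)]], simp, simp, goal_cases)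
      case (1 n2 v2 A2)
      note h2 = this
      then have v2: "A2 = A" "drop (v2 5) w = enc_trans \<delta> @ 3 # ys" "v2 4 = 0" "v2 7 = m" "v2 10 = q0"
          "v2 6 = v 6" "v2 13 = v 13" "v2 14 = v 14"
        using h1 2 by (auto simp: same_except_def)
      show ?case unfolding wp_simps
      proof (rule wp_mono[OF wp_letters_code[where w = w and \<delta> = \<delta> and xs = ys and ?q0.0 = q0 and k = k and F = F and U = U]], goal_cases)
        case (14 n3 v3 A3)
        note h3 = this
        then have A3: "A3 = A(2 := reach \<delta> q0 ?g)" and v3: "v3 4 = 0" "v3 7 = m" "v3 12 = v2 5"
            "v3 15 = v 14 div v 13 ^ v 6"
          using v2 by (auto simp: same_except_def)
        have tape3: "input_tape w A3" using tape by (simp add: A3 input_tape_def)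
        have n3: "n3 \<le> n + 12 * U + 2 + 50 * U ^ 4" using h1 h2 h3 by simp
        have same3: "same_except sim_regs v v3" using h1 h2 h3 by (auto simp: same_except_def)
        show ?case
        proof (rule wp_mono[OF wp_skip_to_3[OF tape3 _ trans12 U(1), where xs = ys]], goal_cases)
          case (2 n4 v4 A4)
          note h4 = this
          then have v4: "v4 4 = 0" "v4 7 = m" "v4 15 = v 14 div v 13 ^ v 6" "A4 = A3"
              "drop (Suc (v4 5)) w = ys"
            using v3 input_tape_Cons[OF tape3, of "v4 5" 3 ys] by (auto simp: same_except_def)
          have same4: "same_except sim_regs v v4" using same3 h4 by (auto simp: same_except_def)
          show ?case
          proof (rule wp_mono[OF wp_finals[where w = w and F = F and xs = xs and U = U]], goal_cases)
            case (7 n5 v5 A5)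
            note h5 = this
            then have v5: "v5 4 = 0" "v5 7 = m" "v5 15 = v 14 div v 13 ^ v 6" "A5 = A3"
                "drop (Suc (v5 5)) w = xs" "v5 19 = 0 \<longleftrightarrow> ?g \<notin> nfa_lang N"
              using v4 input_tape_Cons[OF tape3, of "v5 5" 3 xs] lang by (auto simp: same_except_def A3)
            have same5: "same_except sim_regs v v5" using same4 h5 by (auto simp: same_except_def)
            show ?case
            proof (rule wp_mono[OF wp_clear[where U = U]], goal_cases)
              case (4 n6 v6 A6)
              have v6: "v6 4 = 0" "v6 15 = v 14 div v 13 ^ v 6" "v6 5 = Suc (v5 5)"
                  "v6 19 = 0 \<longleftrightarrow> ?g \<notin> nfa_lang N"
                using 4 v5 by (auto simp: same_except_def)
              have same6: "same_except sim_regs v v6" using same5 4 by (auto simp: same_except_def)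
              have old: "v6 20 = v 20" "v6 21 = v 21"
                using h1 h2 h3 h4 h5 4 by (auto simp: same_except_def)
              have "A6 = A" using 4 v5 v A3 by (auto simp: fun_eq_iff)
              moreover have "n6 + 6 \<le> n + 110 * U ^ 4" using 4 h4 h5 n3 pw by simp
              ultimately show ?case using v6 old same6 v5(5)
                by (auto simp: flag_def same_except_def)
            qed (use v5 m reach_bound[OF wf[unfolded N], of ?g] in \<open>simp_all add: A3\<close>)
          qed (use v4 tape3 U in \<open>auto simp: ys_def\<close>)
        qed (use v2 v3 in auto)
      qed (use v2 v tape U m wf N in \<open>auto simp: input_tape_def\<close>)
    qed
  qed
qed


section \<open>Search through the candidates\<close>

definition all_code :: pcom where
  "all_code = Copy 20 4 ;; Copy 21 4 ;; Copy 5 25 ;; PWhile (\<lambda>b. b 0 \<or> b 1) 5 sim_code"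

lemma length_enc_nfa: "length As \<le> length (concat (map enc_nfa As))"
  by (induction As) (auto simp: enc_nfa_def enc_nat_def)

text \<open>With no automaton no quotient is formed and flag 21 stays down; flag 20 is then down as
  well, so the search accepts at once.\<close>

lemma wp_all_code:
  assumes tape: "input_tape w A" and pos: "drop (v 25) w = concat (map enc_nfa As)"
    and v: "v 4 = 0" "A 3 = {}" "A 2 = {}" "0 < v 13" and wf: "\<forall>N\<in>set As. wf_nfa k N"
    and U: "length w \<le> U" "1 \<le> U" "v 13 \<le> U" "v 14 \<le> U" "v 6 \<le> U"
  shows "wp all_code (\<lambda>n' v' A'. n' \<le> n + 120 * U ^ 5 \<and> A' = A \<and> same_except sim_regs v v' \<and>
     (v' 20 = 0 \<longleftrightarrow> (\<forall>N\<in>set As. digit_word (v 13) (v 6) (v 14) \<in> nfa_lang N)) \<and>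
     (v' 21 = 0 \<longleftrightarrow> As = [] \<or> v 14 div v 13 ^ v 6 = 0)) n v A"
proof -
  note pw = powers_mono[OF U(2)]
  show ?thesis unfolding all_code_def wp_Seq wp_simps
  proof (rule wp_while[where m = "length As" and I = "\<lambda>i n' v' A'. n' \<le> n + 3 + i * (111 * U ^ 4) \<and> A' = A \<and>
     same_except sim_regs v v' \<and> drop (v' 5) w = concat (map enc_nfa (drop i As)) \<and>
     (v' 20 = 0 \<longleftrightarrow> (\<forall>N\<in>set (take i As). digit_word (v 13) (v 6) (v 14) \<in> nfa_lang N)) \<and>
     (v' 21 = 0 \<longleftrightarrow> i = 0 \<or> v 14 div v 13 ^ v 6 = 0)"], goal_cases)
    case 1
    show ?case using pos v by (simp add: same_except_def)
  next
    case (2 i n' v' A')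
    then have c: "drop (v' 5) w = enc_nfa (As ! i) @ concat (map enc_nfa (drop (Suc i) As))"
      by (simp flip: Cons_nth_drop_Suc)
    obtain m \<delta> q0 F where N: "As ! i = (m, \<delta>, q0, F)" by (metis prod_cases4)
    have "starts_number (enc_nfa (As ! i) @ concat (map enc_nfa (drop (Suc i) As)))"
      using starts_number_enc_nat by (simp add: N enc_nfa_def)
    moreover have tape': "input_tape w A'" using tape 2 by simp
    ultimately have test: "v' 5 \<in> A 0 \<or> v' 5 \<in> A (Suc 0)" using input_tape_starts_number[OF tape c] by blast
    have v': "v' 4 = 0" "v' 13 = v 13" "v' 14 = v 14" "v' 6 = v 6" using 2 v by (auto simp: same_except_def)
    have "wp sim_code (\<lambda>n' v' A'. n' \<le> n + 3 + Suc i * (111 * U ^ 4) \<and> A' = A \<and>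
       same_except sim_regs v v' \<and> drop (v' 5) w = concat (map enc_nfa (drop (Suc i) As)) \<and>
       (v' 20 = 0 \<longleftrightarrow> (\<forall>N\<in>set (take (Suc i) As). digit_word (v 13) (v 6) (v 14) \<in> nfa_lang N)) \<and>
       (v' 21 = 0 \<longleftrightarrow> Suc i = 0 \<or> v 14 div v 13 ^ v 6 = 0)) (n' + 1) v' A'"
    proof (rule wp_mono[OF wp_sim_code[where v = v' and w = w and N = "As ! i" and
        xs = "concat (map enc_nfa (drop (Suc i) As))" and k = k and U = U, OF tape' c]], goal_cases)
      case (11 n1 v1 A1)
      have "n1 \<le> n + 3 + Suc i * (111 * U ^ 4)" using 11 2 pw by simp
      moreover have "same_except sim_regs v v1" using 11 2 by (auto simp: same_except_def)
      ultimately show ?case using 11 2 v' by (auto simp: take_Suc_conv_app_nth)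
    qed (use 2 v v' tape wf U in auto)
    then show ?case using 2 test by (simp add: flag_def)
  next
    case (3 n' v' A')
    have "length (drop (v 25) w) \<le> length w" by simp
    then have "length As \<le> U" using U length_enc_nfa[of As] unfolding pos by simp
    then have "length As * (111 * U ^ 4) \<le> U * (111 * U ^ 4)" by simp
    also have "\<dots> = 111 * U ^ 5" by (simp only: mult_powers)
    finally have "n' + 1 \<le> n + 120 * U ^ 5" using 3 pw by linarith
    moreover have "drop (v' 5) w = []" using 3 by simp
    ultimately show ?case using 3 input_tape_Nil[OF tape, of "v' 5"] by (auto simp: flag_def)
  qed
qed

definition main_code :: pcom where
  "main_code = PWhile (\<lambda>b. b 4) 23 (all_code ;;
     PIf (\<lambda>b. b 4) 20 (Inc 23 ;; Inc 22) (PIf (\<lambda>b. b 4) 21 (Inc 14) (Inc 23)))"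

text \<open>Overflow shows only after a candidate has been simulated, so g = D^k may be tested too.
  Hence acceptance yields some g without a bound, while rejection excludes all g below D^k.\<close>

lemma wp_main_code:
  assumes tape: "input_tape w A" and pos: "drop (v 25) w = concat (map enc_nfa As)"
    and v: "v 4 = 0" "A 3 = {}" "A 2 = {}" "0 < v 13" "v 14 = 0" "v 22 = 0" "v 23 = 0"
    and wf: "\<forall>N\<in>set As. wf_nfa k' N"
    and U: "length w \<le> U" "1 \<le> U" "v 13 \<le> U" "v 6 \<le> U" "v 13 ^ v 6 < U"
  shows "wp main_code (\<lambda>n' v' A'. n' \<le> n + 130 * U ^ 6 \<and>
     (v' 22 \<noteq> 0 \<longrightarrow> (\<exists>g. \<forall>N\<in>set As. digit_word (v 13) (v 6) g \<in> nfa_lang N)) \<and>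
     ((\<exists>g < v 13 ^ v 6. \<forall>N\<in>set As. digit_word (v 13) (v 6) g \<in> nfa_lang N) \<longrightarrow> v' 22 \<noteq> 0)) n v A"
proof -
  note pw = powers_mono[OF U(2)]
  let ?E = "v 13 ^ v 6"
  define ok where "ok = (\<lambda>g. \<forall>N\<in>set As. digit_word (v 13) (v 6) g \<in> nfa_lang N)"
  define over where "over = (\<lambda>g. \<not> (As = [] \<or> g div ?E = 0))"
  \<comment> \<open>The first candidate that succeeds or overflows. It is at most D^k, because D^k
    overflows unless there are no automata, and then it succeeds.\<close>
  define stop where "stop = (LEAST g. ok g \<or> over g)"
  have "ok ?E \<or> over ?E" using v by (auto simp: ok_def over_def)
  then have stop: "ok stop \<or> over stop" "stop \<le> ?E" and before: "\<And>g. g < stop \<Longrightarrow> \<not> (ok g \<or> over g)"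
    unfolding stop_def by (rule LeastI, rule Least_le) (rule not_less_Least)
  \<comment> \<open>A search that ends by overflow has passed all g below D^k without
    success.\<close>
  have complete: "ok stop" if "g < ?E" "ok g" for g
  proof (rule ccontr)
    assume "\<not> ok stop"
    then have "?E \<le> stop" using stop v by (auto simp: over_def div_eq_0_iff)
    then show False using before[of g] that by simp
  qed
  show ?thesis unfolding main_code_def
  proof (rule wp_while[where m = "Suc stop" and I = "\<lambda>i n' v' A'. n' \<le> n + i * (124 * U ^ 5) \<and> A' = A \<and>
     same_except (sim_regs \<union> {14, 22, 23}) v v' \<and>
     (if i \<le> stop then v' 14 = i \<and> v' 22 = 0 \<and> v' 23 = 0 else v' 23 \<noteq> 0 \<and> (v' 22 \<noteq> 0 \<longleftrightarrow> ok stop))"], goal_cases)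
    case 1
    show ?case using v by (simp add: same_except_def)
  next
    case (2 i n' v' A')
    then have i: "i \<le> stop" by simp
    have v': "v' 4 = 0" "v' 13 = v 13" "v' 6 = v 6" "v' 25 = v 25" using 2 v by (auto simp: same_except_def)
    have body: "wp all_code (wp (PIf (\<lambda>b. b 4) 20 (Inc 23 ;; Inc 22) (PIf (\<lambda>b. b 4) 21 (Inc 14) (Inc 23)))
      (\<lambda>n' v' A'. n' \<le> n + Suc i * (124 * U ^ 5) \<and> A' = A \<and>
       same_except (sim_regs \<union> {14, 22, 23}) v v' \<and>
       (if Suc i \<le> stop then v' 14 = Suc i \<and> v' 22 = 0 \<and> v' 23 = 0
        else v' 23 \<noteq> 0 \<and> (v' 22 \<noteq> 0 \<longleftrightarrow> ok stop)))) (n' + 1) v' A'"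
    proof (rule wp_mono[OF wp_all_code[where w = w and As = As and k = k' and U = U]], goal_cases)
      case (13 n1 v1 A1)
      have n1: "n1 + 3 \<le> n + Suc i * (124 * U ^ 5)" using 13 2 pw by simp
      have same: "same_except (sim_regs \<union> {14, 22, 23}) v v1" using 13 2 by (auto simp: same_except_def)
      have v1: "v1 4 = 0" "v1 14 = i" "v1 22 = 0" "v1 23 = 0"
        using 13 2 v' i by (auto simp: same_except_def)
      have ok: "v1 20 = 0 \<longleftrightarrow> ok i" and over: "v1 21 = 0 \<longleftrightarrow> \<not> over i"
        using 13 2 v' i by (auto simp: ok_def over_def)
      show ?case
      proof (cases "ok i \<or> over i")
        case True
        then have "stop = i" using before[of i] i by (cases "i < stop") auto
        then show ?thesis using True ok over v1 n1 same 13 2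
          by (auto simp: flag_def same_except_def)
      next
        case False
        then have "i \<noteq> stop" using stop by auto
        then show ?thesis using False ok over v1 n1 same 13 2 i
          by (auto simp: flag_def same_except_def)
      qed
    qed (use 2 v v' tape pos wf U i stop in auto)
    then show ?case using 2 i v' by (simp add: flag_def)
  next
    case (3 n' v' A')
    have "Suc stop \<le> U" using stop U by simp
    then have "Suc stop * (124 * U ^ 5) \<le> U * (124 * U ^ 5)" by (rule mult_le_mono1)
    also have "\<dots> = 124 * U ^ 6" by (simp only: mult_powers)
    finally have "n' + 1 \<le> n + 130 * U ^ 6" using 3 pw by linarith
    moreover have "v' 4 = 0" using 3 v by (auto simp: same_except_def)
    ultimately show ?case using 3 complete by (auto simp: flag_def ok_def)
  qed
qed

section \<open>The base D from the input length\<close>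

definition init_code :: pcom where
  "init_code = read_num 6 ;; Copy 25 5 ;; Copy 5 4 ;; PWhile (\<lambda>b. b 0 \<or> b 1) 5 (Inc 5) ;; Copy 24 5 ;;
     Copy 18 4 ;;
     PWhile (\<lambda>b. \<not> b 24) 18 (Copy 26 4 ;; PWhile (\<lambda>b. \<not> b 24) 26 (Inc 13 ;; Inc 13 ;; Inc 26) ;; Inc 18)"

text \<open>Every input symbol carries bit 0 or bit 1, so the first cell with neither is the end of
  the input.\<close>

lemma wp_find_end:
  assumes tape: "input_tape w A" and v: "v 5 = 0" and w: "\<forall>x\<in>set w. x = 1 \<or> x = 2 \<or> x = 3"
  shows "wp (PWhile (\<lambda>b. b 0 \<or> b 1) 5 (Inc 5))
    (\<lambda>n' v' A'. n' = n + 2 * length w + 1 \<and> A' = A \<and> same_except {5} v v' \<and> v' 5 = length w) n v A"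
proof (rule wp_while[where m = "length w" and I = "\<lambda>i n' v' A'. n' = n + 2 * i \<and> A' = A \<and>
    same_except {5} v v' \<and> v' 5 = i"], goal_cases)
  case 1
  show ?case using v by (simp add: same_except_def)
next
  case (2 i n' v' A')
  have "w ! i = 1 \<or> w ! i = 2 \<or> w ! i = 3" using w 2(1) by simp
  moreover have "drop (v' 5) w = w ! i # drop (Suc i) w" using 2 by (simp add: Cons_nth_drop_Suc)
  note input_tape_Cons[OF tape this]
  ultimately show ?case using 2 by (auto simp: flag_def same_except_def)
next
  case (3 n' v' A')
  then show ?case using input_tape_Nil[OF tape, of "v' 5"] by (simp add: flag_def)
qed

lemma wp_add_twice:
  assumes v: "v 26 = 0"
  shows "wp (PWhile (\<lambda>b. \<not> b 24) 26 (Inc 13 ;; Inc 13 ;; Inc 26))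
    (\<lambda>n' v' A'. n' = n + 4 * v 24 + 1 \<and> A' = A \<and> same_except {13, 26} v v' \<and> v' 13 = v 13 + 2 * v 24) n v A"
proof (rule wp_while[where m = "v 24" and I = "\<lambda>i n' v' A'. n' = n + 4 * i \<and> A' = A \<and>
    same_except {13, 26} v v' \<and> v' 26 = i \<and> v' 13 = v 13 + 2 * i"], goal_cases)
  case 1
  show ?case using v by (simp add: same_except_def)
next
  case (2 i n' v' A')
  then have "v' 24 = v 24" by (auto simp: same_except_def)
  then show ?case using 2 by (auto simp: flag_def same_except_def)
next
  case (3 n' v' A')
  then have "v' 24 = v 24" by (auto simp: same_except_def)
  then show ?case using 3 by (auto simp: flag_def same_except_def)
qed

lemma wp_square:
  assumes v: "v 4 = 0" "v 18 = 0" "v 13 = 0"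
  shows "wp (PWhile (\<lambda>b. \<not> b 24) 18 (Copy 26 4 ;; PWhile (\<lambda>b. \<not> b 24) 26 (Inc 13 ;; Inc 13 ;; Inc 26) ;; Inc 18))
    (\<lambda>n' v' A'. n' = n + v 24 * (4 * v 24 + 4) + 1 \<and> A' = A \<and> same_except {13, 18, 26} v v' \<and>
       v' 13 = 2 * v 24 * v 24) n v A"
proof (rule wp_while[where m = "v 24" and I = "\<lambda>i n' v' A'. n' = n + i * (4 * v 24 + 4) \<and> A' = A \<and>
    same_except {13, 18, 26} v v' \<and> v' 18 = i \<and> v' 13 = i * (2 * v 24)"], goal_cases)
  case 1
  show ?case using v by (simp add: same_except_def)
next
  case (2 i n' v' A')
  then have v': "v' 24 = v 24" "v' 4 = 0" using v by (auto simp: same_except_def)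
  have "wp (PWhile (\<lambda>b. \<not> b 24) 26 (Inc 13 ;; Inc 13 ;; Inc 26)) (wp (Inc 18)
    (\<lambda>n' v' A'. n' = n + Suc i * (4 * v 24 + 4) \<and> A' = A \<and>
    same_except {13, 18, 26} v v' \<and> v' 18 = Suc i \<and> v' 13 = Suc i * (2 * v 24))) (n' + 2) (v'(26 := 0)) A'"
    by (rule wp_mono[OF wp_add_twice]) (use 2 v' in \<open>auto simp: same_except_def\<close>)
  then show ?case using 2 v' by (simp add: flag_def)
next
  case (3 n' v' A')
  then have "v' 24 = v 24" by (auto simp: same_except_def)
  then show ?case using 3 by (auto simp: flag_def)
qed

lemma wp_init_code:
  assumes tape: "input_tape w A" and w: "w = enc_nat k @ xs" "\<forall>x\<in>set w. x = 1 \<or> x = 2 \<or> x = 3"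
    and U: "length w \<le> U" "1 \<le> U"
  shows "wp init_code (\<lambda>n' v' A'. n' \<le> 30 * U ^ 2 \<and> A' = A \<and> drop (v' 25) w = xs \<and> v' 6 = k \<and>
     v' 13 = 2 * length w * length w \<and> (\<forall>r \<in> {4, 14, 22, 23}. v' r = 0)) 0 (\<lambda>_. 0) A"
proof -
  have pos: "drop ((\<lambda>_. 0) 5) w = enc_nat k @ xs" using w by simp
  show ?thesis unfolding init_code_def wp_Seq
  proof (rule wp_mono[OF wp_read_num[OF tape pos _ _ _ U(1)]], simp, simp, simp, goal_cases)
    case (1 n1 v1 A1)
    note h1 = this
    show ?case unfolding wp_simps
    proof (rule wp_mono[OF wp_find_end[where w = w]], goal_cases)
      case (4 n2 v2 A2)
      note h2 = this
      show ?case
      proof (rule wp_mono[OF wp_square], goal_cases)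
        case (4 n3 v3 A3)
        have "v2 5 * (4 * v2 5) \<le> 4 * U ^ 2"
          using h2 U mult_le_mono[of "length w" U "length w" U] by (simp add: power2_eq_square)
        moreover have "v2 5 \<le> U" using h2 U by simp
        ultimately have "n3 \<le> 30 * U ^ 2"
          using 4 h1 h2 U powers_mono[OF U(2)] by (simp add: add_mult_distrib2)
        then show ?case using 4 h1 h2 by (auto simp: same_except_def)
      qed (use h1 h2 in \<open>auto simp: same_except_def\<close>)
    qed (use h1 tape w in \<open>auto simp: same_except_def\<close>)
  qed
qed

section \<open>Correctness and running time\<close>

definition solver :: pcom where
  "solver = init_code ;; main_code"

lemma solver_wf: "pcom_wf solver"
  by (simp add: solver_def init_code_def main_code_def all_code_def sim_code_def letters_code_def
      divmod_code_def step_code_def read_num_def)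

lemma enc_instance_symbols: "\<forall>x \<in> set (enc_instance (k, As)). x = 1 \<or> x = 2 \<or> x = 3"
  by (auto simp: enc_instance_def enc_nfa_def enc_nat_def split: if_splits)

text \<open>By the unary encoding the input length can stand in for the largest number of
  states.\<close>

lemma nfa_states_less_length:
  assumes "A \<in> set As"
  shows "fst A < length (enc_instance (k, As))"
proof -
  have "length (enc_nfa A) \<le> length (concat (map enc_nfa As))"
    using assms by (induction As) auto
  moreover have "fst A < length (enc_nfa A)"
    by (cases A) (simp add: enc_nfa_def enc_nat_def)
  ultimately show ?thesis by (simp add: enc_instance_def)
qed

text \<open>\<open>U\<close> is D^(k + 1), which dominates k, D and the input length and, as D \<ge>
  2, strictly exceeds D^k. The factor 160 is 30 for the initialisation plus 130 for the
  search.\<close>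

lemma solver_correct:
  fixes k :: nat and As :: "nfa list"
  defines "w \<equiv> enc_instance (k, As)"
  defines "U \<equiv> (2 * length w * length w) ^ (k + 1)"
  assumes "promise (k, As)" and "2 \<le> length w"
  shows "\<exists>n v A. pexec solver (\<lambda>_. 0) (input_sets w) n v A \<and> n \<le> 160 * U ^ 6 \<and>
     (v 22 \<noteq> 0 \<longleftrightarrow> intersection_nonempty (k, As))"
proof -
  let ?N = "length w"
  define D where "D = 2 * ?N * ?N"
  have D: "2 \<le> D" using mult_le_mono[OF assms(4,4)] unfolding D_def mult.assoc by linarith
  have U: "U = D * D ^ k" by (simp add: U_def D_def)
  have "1 \<le> D ^ k" using D by simp
  have "D \<le> U" using D unfolding U by simp
  have "?N \<le> ?N * ?N" by (rule le_square)
  then have "?N \<le> D" unfolding D_def mult.assoc by linarith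
  have "2 * D ^ k \<le> U" unfolding U using D by (intro mult_le_mono1)
  then have DU: "D ^ k < U" using \<open>1 \<le> D ^ k\<close> by linarith
  have w: "w = enc_nat k @ concat (map enc_nfa As)" by (simp add: w_def enc_instance_def)
  then have "k \<le> ?N" by (simp add: enc_nat_def)
  have w3: "\<forall>x\<in>set w. x = 1 \<or> x = 2 \<or> x = 3" unfolding w_def by (rule enc_instance_symbols)
  have empty: "input_sets w 2 = {}" "input_sets w 3 = {}"
  proof -
    have "\<not> bit (w ! i) 2 \<and> \<not> bit (w ! i) 3" if "i < ?N" for i
    proof -
      have "w ! i < 4" using w3 nth_mem[OF that] by fastforce
      then show ?thesis using not_bit_small[of "w ! i"] by simp
    qed
    then show "input_sets w 2 = {}" "input_sets w 3 = {}" by (auto simp: input_sets_def)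
  qed
  have tape: "input_tape w (input_sets w)" by (simp add: input_tape_def)
  have wf: "\<forall>A\<in>set As. wf_nfa k A" using assms(3) by (auto simp: promise_def)
  have states: "\<forall>A\<in>set As. 2 * fst A * fst A < D"
  proof
    fix A assume "A \<in> set As"
    then have "fst A < ?N" unfolding w_def by (rule nfa_states_less_length)
    then have "fst A * fst A < ?N * ?N" by (intro mult_strict_mono) auto
    then show "2 * fst A * fst A < D" by (simp add: D_def)
  qed
  have U1: "1 \<le> U" "?N \<le> U" "k \<le> U" using D \<open>D \<le> U\<close> \<open>?N \<le> D\<close> \<open>k \<le> ?N\<close> by linarith+
  have "wp solver (\<lambda>n v A. n \<le> 160 * U ^ 6 \<and> (v 22 \<noteq> 0 \<longleftrightarrow> intersection_nonempty (k, As)))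
     0 (\<lambda>_. 0) (input_sets w)"
    unfolding solver_def wp_Seq
  proof (rule wp_mono[OF wp_init_code[OF tape w w3 U1(2,1)]], goal_cases)
    case (1 n1 v1 A1)
    then have v1: "v1 6 = k" "v1 13 = D" by (simp_all add: D_def)
    show ?case
    proof (rule wp_mono[OF wp_main_code[where w = w and As = As and k' = k and U = U]], goal_cases)
      case (16 n2 v2 A2)
      have "n2 \<le> 160 * U ^ 6" using 16 1 powers_mono[OF U1(1)] by linarith
      moreover have "intersection_nonempty (k, As)" if "v2 22 \<noteq> 0"
        using 16 that v1 digit_word_nonempty[of As D k] by auto
      moreover have "v2 22 \<noteq> 0" if "intersection_nonempty (k, As)"
        using 16 v1 nonempty_digit_word[OF assms(3) states _ that] D by simp
      ultimately show ?case by blast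
    qed (use 1 v1 tape empty wf U1 DU D \<open>D \<le> U\<close> in auto)
  qed
  then show ?thesis unfolding wp_def by auto
qed

text \<open>As N \<ge> 2, the base 2 * N^2 is at most N^3, so n is at most 160 * N^(18 * (k + 1)).
  The tape simulation squares this, which gives the exponent 36 * k + 36; the constants are below
  2^24 \<le> N^24.\<close>

lemma time_bound:
  fixes N k :: nat
  assumes "2 \<le> N" and "n \<le> 160 * ((2 * N * N) ^ (k + 1)) ^ 6"
  shows "cost 0 n + 4 * n + 6 \<le> N ^ (36 * k + 60)"
proof -
  have "2 * N * N \<le> N ^ 3" using assms(1) by (simp add: power3_eq_cube)
  then have "((2 * N * N) ^ (k + 1)) ^ 6 \<le> ((N ^ 3) ^ (k + 1)) ^ 6"
    by (intro power_mono) auto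
  also have "\<dots> = N ^ (18 * (k + 1))" by (simp only: power_mult[symmetric]) (simp add: algebra_simps)
  finally have n: "n \<le> 160 * N ^ (18 * (k + 1))" (is "_ \<le> 160 * ?P") using assms(2) by linarith
  have "1 \<le> ?P" using assms(1) by simp
  then have "1 * ?P \<le> ?P * ?P" by (intro mult_le_mono1)
  moreover have "n * n \<le> (160 * ?P) * (160 * ?P)" using n by (intro mult_le_mono)
  then have "n * n \<le> 25600 * (?P * ?P)" by simp
  moreover have "cost 0 n = 8 * (n * n) + 10 * n" by (simp add: cost_def algebra_simps)
  ultimately have "cost 0 n + 4 * n + 6 \<le> 8 * (25600 * (?P * ?P)) + 14 * (160 * (?P * ?P)) + 6 * (?P * ?P)"
    using n \<open>1 \<le> ?P\<close> by linarith
  also have "\<dots> \<le> 2 ^ 24 * (?P * ?P)" by simp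
  also have "\<dots> \<le> N ^ 24 * (?P * ?P)" using assms(1) by (intro mult_le_mono1 power_mono) auto
  also have "\<dots> = N ^ (36 * k + 60)" by (simp add: add.commute flip: power_add)
  finally show ?thesis .
qed

theorem theorem18:
  shows "\<exists>M f. wf_tm M \<and> tm_computable f \<and>
    (\<forall>k As. promise (k, As) \<longrightarrow>
       (\<exists>t \<le> length (enc_instance (k, As)) ^ f k.
          tm_halted M (tm_run M t (tm_init (enc_instance (k, As))))
          \<and> (fst (tm_run M t (tm_init (enc_instance (k, As)))) = 1
               \<longleftrightarrow> intersection_nonempty (k, As))))"
proof (rule exI, rule exI, intro conjI allI impI)
  let ?M = "machine 22 solver"
  \<comment> \<open>The slope 36 is written as \<open>Suc 35\<close> to fit
    \<open>tm_computable_linear\<close>.\<close>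
  let ?f = "\<lambda>k. Suc 35 * k + 60"
  show "wf_tm ?M" by (rule machine_wf[OF solver_wf])
  show "tm_computable ?f" by (rule tm_computable_linear)
  fix k As
  assume promise: "promise (k, As)"
  let ?w = "enc_instance (k, As)"
  show "\<exists>t \<le> length ?w ^ ?f k. tm_halted ?M (tm_run ?M t (tm_init ?w)) \<and>
      (fst (tm_run ?M t (tm_init ?w)) = 1 \<longleftrightarrow> intersection_nonempty (k, As))"
  \<comment> \<open>An encoding of length 1 is out of reach for \<open>time_bound\<close>; here the
    empty word is the witness.\<close>
  proof (cases "k = 0 \<and> As = []")
    case True
    then have "?w = [2]" "intersection_nonempty (k, As)"
      by (auto simp: enc_instance_def enc_nat_def intersection_nonempty_def)
    then show ?thesis using machine_accepts_two[of 22 solver] by (intro exI[of _ 1]) simp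
  next
    case False
    have start: "?w \<noteq> []" "2 \<le> length ?w \<and> (?w ! 0 = 1 \<or> ?w ! 0 = 2 \<and> ?w ! 1 = 1 \<and> 1 < length ?w)"
    proof -
      show "?w \<noteq> []" by (simp add: enc_instance_def enc_nat_def)
      show "2 \<le> length ?w \<and> (?w ! 0 = 1 \<or> ?w ! 0 = 2 \<and> ?w ! 1 = 1 \<and> 1 < length ?w)"
      proof (cases k)
        case (Suc k')
        then show ?thesis by (simp add: enc_instance_def enc_nat_def)
      next
        case 0
        then obtain A Bs where As: "As = A # Bs" using False by (cases As) auto
        obtain m \<delta> q0 F where A: "A = (m, \<delta>, q0, F)" by (metis prod_cases4)
        \<comment> \<open>The initial state is below m, so the encoding of the first automaton puts
          a 1 right after the 2 that encodes k = 0.\<close>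
        have "0 < m" using promise by (auto simp: promise_def As A wf_nfa_def)
        then show ?thesis using 0 by (cases m) (auto simp: enc_instance_def As A enc_nfa_def enc_nat_def)
      qed
    qed
    have "\<forall>x\<in>set ?w. x < 4" using enc_instance_symbols[of k As] by fastforce
    obtain n v A where run: "pexec solver (\<lambda>_. 0) (input_sets ?w) n v A"
      and n: "n \<le> 160 * ((2 * length ?w * length ?w) ^ (k + 1)) ^ 6"
      and res: "v 22 \<noteq> 0 \<longleftrightarrow> intersection_nonempty (k, As)"
      using solver_correct[OF promise] start by blast
    obtain t where t: "t \<le> cost 0 n + 4 * n + 6" "tm_halted ?M (tm_run ?M t (tm_init ?w))"
        "fst (tm_run ?M t (tm_init ?w)) = 1 \<longleftrightarrow> v 22 \<noteq> 0"
      using machine_run[OF solver_wf _ \<open>\<forall>x\<in>set ?w. x < 4\<close> _ start(1) run, of 22] start by auto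
    have "t \<le> length ?w ^ ?f k"
      using t(1) time_bound[OF _ n] start by simp
    then show ?thesis using t res by blast
  qed
qed

end
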